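(* Let $T\in B(\mathcal H)$ be a subnormal operator and suppose $\mathcal S(T,T^* )$ is an SI semigroup. Then $T$ is essentially normal if and only if $\operatorname{Area}(\sigma_e(T))=0$.
   Context: $\mathcal H$ is a complex Hilbert space. $T$ is subnormal if there are a Hilbert space $\mathcal K\supset\mathcal H$ and a normal operator $N$ on $\mathcal K$ whose restriction to $\mathcal H$ equals $T$. With $\pi:B(\mathcal H)\to B(\mathcal H)/K(\mathcal H)$ the quotient map modulo the compact operators, $T$ is essentially normal if $\pi(T)$ is normal, and $\sigma_e(T)=\sigma(\pi(T))$ is the essential spectrum. Area is planar Lebesgue measure. $\mathcal S(T,T^* )$ is the multiplicative semigroup of all finite nonempty products of $T$ and $T^*$. An ideal of a semigroup $\mathcal S$ is a nonempty subset $J\subset\mathcal S$ with $XA,AX\in J$ for $A\in J$, $X\in\mathcal S$. $\mathcal S$ is an SI (selfadjoint-ideal) semigroup if every ideal $J$ of $\mathcal S$ satisfies $J^*=\{A^*:A\in J\}\subset J$. *)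

theory Defs
  imports "HOL-Analysis.Analysis" "HOL-Algebra.QuotRing"
begin

text \<open>Complex Hilbert spaces. The inner product is linear in its first argument; its definiteness
  is inherited from the norm through the axiom \<open>cinner_self\<close>, and completeness from \<open>banach\<close>.\<close>

class complex_hilbert_space = banach +
  fixes scaleC :: "complex \<Rightarrow> 'a \<Rightarrow> 'a" (infixr \<open>*\<^sub>C\<close> 75)
    and cinner :: "'a \<Rightarrow> 'a \<Rightarrow> complex"
  assumes scaleC_add_right: "c *\<^sub>C (x + y) = c *\<^sub>C x + c *\<^sub>C y"
    and scaleC_add_left: "(c + d) *\<^sub>C x = c *\<^sub>C x + d *\<^sub>C x"
    and scaleC_scaleC: "c *\<^sub>C d *\<^sub>C x = (c * d) *\<^sub>C x"
    and scaleR_scaleC: "r *\<^sub>R x = complex_of_real r *\<^sub>C x"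
    and cinner_commute: "cinner x y = cnj (cinner y x)"
    and cinner_add_left: "cinner (x + y) z = cinner x z + cinner y z"
    and cinner_scaleC_left: "cinner (c *\<^sub>C x) y = c * cinner x y"
    and cinner_self: "cinner x x = complex_of_real ((norm x)\<^sup>2)"

definition bounded_clinear ::
    "('a::complex_hilbert_space \<Rightarrow> 'b::complex_hilbert_space) \<Rightarrow> bool" where
  "bounded_clinear T \<longleftrightarrow> bounded_linear T \<and> (\<forall>c x. T (c *\<^sub>C x) = c *\<^sub>C T x)"

definition cadjoint ::
    "('a::complex_hilbert_space \<Rightarrow> 'b::complex_hilbert_space) \<Rightarrow> 'b \<Rightarrow> 'a" where
  "cadjoint T = (THE S. \<forall>x y. cinner (T x) y = cinner x (S y))"

definition normal_operator :: "('a::complex_hilbert_space \<Rightarrow> 'a) \<Rightarrow> bool" where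
  "normal_operator N \<longleftrightarrow> bounded_clinear N \<and> cadjoint N \<circ> N = N \<circ> cadjoint N"

text \<open>The inclusion of the space in a larger Hilbert space \<open>'k\<close> is rendered by a linear isometry
  \<open>V\<close>. HOL cannot quantify over the type \<open>'k\<close> inside a formula, so \<open>'k\<close> is a parameter;
  if it is left arbitrary in a theorem assuming subnormality, the assumption says that
  some Hilbert space \<open>'k\<close> carries a normal extension.\<close>

definition subnormal ::
    "'k::complex_hilbert_space itself \<Rightarrow> ('a::complex_hilbert_space \<Rightarrow> 'a) \<Rightarrow> bool" where
  "subnormal (K :: 'k itself) T \<longleftrightarrow> bounded_clinear T \<and>
    (\<exists>(V :: 'a \<Rightarrow> 'k) (N :: 'k \<Rightarrow> 'k).
       bounded_clinear V \<and> (\<forall>x y. cinner (V x) (V y) = cinner x y) \<and>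
       normal_operator N \<and> (\<forall>x. N (V x) = V (T x)))"

definition operator_ring :: "('a::complex_hilbert_space \<Rightarrow> 'a) ring" where
  "operator_ring =
    \<lparr>carrier = {T. bounded_clinear T}, mult = (\<circ>), one = id,
     zero = (\<lambda>_. 0), add = (\<lambda>S T x. S x + T x)\<rparr>"

definition compact_operators :: "('a::complex_hilbert_space \<Rightarrow> 'a) set" where
  "compact_operators = {T. bounded_clinear T \<and> compact (closure (T ` cball 0 1))}"

definition calkin_algebra :: "('a::complex_hilbert_space \<Rightarrow> 'a) set ring" where
  "calkin_algebra = operator_ring Quot compact_operators"

definition calkin_proj ::
    "('a::complex_hilbert_space \<Rightarrow> 'a) \<Rightarrow> ('a \<Rightarrow> 'a) set" where
  "calkin_proj T = compact_operators +>\<^bsub>operator_ring\<^esub> T"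

text \<open>The compact operators being closed under adjoints, the elementwise adjoint of the coset of \<open>T\<close>
  is the coset of \<open>cadjoint T\<close>.\<close>

definition calkin_star ::
    "('a::complex_hilbert_space \<Rightarrow> 'a) set \<Rightarrow> ('a \<Rightarrow> 'a) set" where
  "calkin_star A = cadjoint ` A"

text \<open>When the space is finite-dimensional the Calkin algebra is the zero ring, whose zero is a unit,
  so spectra are then empty.\<close>

definition calkin_spectrum ::
    "('a::complex_hilbert_space \<Rightarrow> 'a) set \<Rightarrow> complex set" where
  "calkin_spectrum A =
    {z. calkin_proj (\<lambda>x. z *\<^sub>C x) \<ominus>\<^bsub>calkin_algebra\<^esub> A \<notin> Units calkin_algebra}"

definition essentially_normal :: "('a::complex_hilbert_space \<Rightarrow> 'a) \<Rightarrow> bool" where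
  "essentially_normal T \<longleftrightarrow>
    calkin_star (calkin_proj T) \<otimes>\<^bsub>calkin_algebra\<^esub> calkin_proj T =
    calkin_proj T \<otimes>\<^bsub>calkin_algebra\<^esub> calkin_star (calkin_proj T)"

definition essential_spectrum :: "('a::complex_hilbert_space \<Rightarrow> 'a) \<Rightarrow> complex set" where
  "essential_spectrum T = calkin_spectrum (calkin_proj T)"

definition star_semigroup ::
    "('a::complex_hilbert_space \<Rightarrow> 'a) \<Rightarrow> ('a \<Rightarrow> 'a) set" where
  "star_semigroup T = {foldr (\<circ>) Ws id | Ws. Ws \<noteq> [] \<and> set Ws \<subseteq> {T, cadjoint T}}"

definition semigroup_ideal :: "('a \<Rightarrow> 'a) set \<Rightarrow> ('a \<Rightarrow> 'a) set \<Rightarrow> bool" where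
  "semigroup_ideal J S \<longleftrightarrow>
    J \<noteq> {} \<and> J \<subseteq> S \<and> (\<forall>A\<in>J. \<forall>X\<in>S. X \<circ> A \<in> J \<and> A \<circ> X \<in> J)"

definition SI_semigroup :: "('a::complex_hilbert_space \<Rightarrow> 'a) set \<Rightarrow> bool" where
  "SI_semigroup S \<longleftrightarrow> (\<forall>J. semigroup_ideal J S \<longrightarrow> cadjoint ` J \<subseteq> J)"

end

theory Submission imports Defs begin

text \<open>The ideal of all words containing \<open>T\<close> is selfadjoint, so \<open>T\<^sup>*\<close> is itself such a word, and either
  \<open>T = T\<^sup>*\<close> or the word has length at least two. In the second case hyponormality (the only
  consequence of subnormality used) forces \<open>\<parallel>T\<parallel> \<le> 1\<close>, and comparing norms letter by letter gives
  \<open>\<parallel>T x\<parallel> \<le> \<parallel>T\<^sup>2 x\<parallel>\<close>, that is, \<open>T\<^sup>* T T = T\<close>. Write \<open>t\<close> and \<open>u\<close> for the classes of \<open>T\<close> and \<open>T\<^sup>*\<close> in the Calkin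
  algebra, and let \<open>0 < \<bar>z\<bar> < 1\<close>. The element \<open>1 - z u\<close> is invertible, and from this and \<open>u t t = t\<close> ring
  identities and the \<open>C\<^sup>*\<close>-identity show that \<open>z - t\<close> is invertible if and only if \<open>t\<close> commutes with \<open>u\<close>. So
  the essential spectrum either lies in the unit circle together with \<open>0\<close>, or contains the punctured
  open disc. No form of Putnam's inequality is needed.\<close>

subsection \<open>Hilbert spaces and adjoints\<close>

lemma cinner_add_right: "cinner x (y + z) = cinner x y + cinner x z"
  for x y z :: "'a::complex_hilbert_space"
  by (metis cinner_add_left cinner_commute complex_cnj_add)

lemma cinner_scaleC_right: "cinner x (c *\<^sub>C y) = cnj c * cinner x y"
  for x y :: "'a::complex_hilbert_space"
  by (metis cinner_commute cinner_scaleC_left complex_cnj_mult)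

lemma cinner_scaleR_left: "cinner (r *\<^sub>R x) y = of_real r * cinner x y"
  for x y :: "'a::complex_hilbert_space"
  by (simp add: scaleR_scaleC cinner_scaleC_left)

lemma cinner_scaleR_right: "cinner x (r *\<^sub>R y) = of_real r * cinner x y"
  for x y :: "'a::complex_hilbert_space"
  by (simp add: scaleR_scaleC cinner_scaleC_right)

lemma cinner_minus_left: "cinner (- x) y = - cinner x y"
  for x y :: "'a::complex_hilbert_space"
  using cinner_scaleR_left[of "-1" x y] by simp

lemma cinner_minus_right: "cinner x (- y) = - cinner x y"
  for x y :: "'a::complex_hilbert_space"
  using cinner_scaleR_right[of x "-1" y] by simp

lemma cinner_diff_left: "cinner (x - y) z = cinner x z - cinner y z"
  for x y z :: "'a::complex_hilbert_space"
  using cinner_add_left[of x "- y" z] by (simp add: cinner_minus_left)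

lemma cinner_diff_right: "cinner x (y - z) = cinner x y - cinner x z"
  for x y z :: "'a::complex_hilbert_space"
  using cinner_add_right[of x y "- z"] by (simp add: cinner_minus_right)

lemma cinner_zero_right [simp]: "cinner x 0 = 0"
  for x :: "'a::complex_hilbert_space"
  using cinner_diff_right[of x 0 0] by simp

lemma Re_cinner_commute: "Re (cinner x y) = Re (cinner y x)"
  for x y :: "'a::complex_hilbert_space"
  by (metis cinner_commute complex_cnj(1) complex.sel(1) cnj.simps(1))

lemma norm_sq_cinner: "(norm x)\<^sup>2 = Re (cinner x x)"
  for x :: "'a::complex_hilbert_space"
  by (simp add: cinner_self)

lemma norm_add_sq: "(norm (x + y))\<^sup>2 = (norm x)\<^sup>2 + 2 * Re (cinner x y) + (norm y)\<^sup>2"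
  for x y :: "'a::complex_hilbert_space"
  by (simp add: norm_sq_cinner cinner_add_left cinner_add_right Re_cinner_commute[of y x])

lemma norm_diff_sq: "(norm (x - y))\<^sup>2 = (norm x)\<^sup>2 - 2 * Re (cinner x y) + (norm y)\<^sup>2"
  for x y :: "'a::complex_hilbert_space"
  using norm_add_sq[of x "- y"] by (simp add: cinner_minus_right)

lemma Re_cinner_le: "Re (cinner x y) \<le> norm x * norm y"
  for x y :: "'a::complex_hilbert_space"
proof -
  have "(norm (x + y))\<^sup>2 \<le> (norm x + norm y)\<^sup>2"
    by (intro power_mono norm_triangle_ineq) simp
  then show ?thesis by (simp add: norm_add_sq power2_sum)
qed

lemma abs_Re_cinner_le: "\<bar>Re (cinner x y)\<bar> \<le> norm x * norm y"
  for x y :: "'a::complex_hilbert_space"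
  using Re_cinner_le[of x y] Re_cinner_le[of "- x" y] by (simp add: cinner_minus_left)

lemma norm_scaleC: "norm (c *\<^sub>C x) = cmod c * norm x"
  for x :: "'a::complex_hilbert_space"
proof -
  have "complex_of_real ((norm (c *\<^sub>C x))\<^sup>2) = (c * cnj c) * cinner x x"
    by (simp only: cinner_self[symmetric] cinner_scaleC_left cinner_scaleC_right) simp
  also have "\<dots> = complex_of_real ((cmod c * norm x)\<^sup>2)"
    by (simp only: complex_norm_square[symmetric] cinner_self power_mult_distrib of_real_mult)
  finally have "(norm (c *\<^sub>C x))\<^sup>2 = (cmod c * norm x)\<^sup>2"
    using of_real_eq_iff by blast
  then show ?thesis by (simp add: power2_eq_iff_nonneg)
qed

lemma scaleC_one [simp]: "1 *\<^sub>C x = x" for x :: "'a::complex_hilbert_space"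
  using scaleR_scaleC[of 1 x] by simp

lemma scaleC_zero_right [simp]: "c *\<^sub>C 0 = (0 :: 'a::complex_hilbert_space)"
  using scaleC_add_right[of c "0 :: 'a" 0] by simp

lemma scaleC_minus_right: "c *\<^sub>C (- x) = - (c *\<^sub>C x)" for x :: "'a::complex_hilbert_space"
  using scaleC_scaleC[of c "- 1" x] scaleC_scaleC[of "- 1" c x] scaleR_scaleC[of "- 1" x]
    scaleR_scaleC[of "- 1" "c *\<^sub>C x"] by simp

lemma scaleC_diff_right: "c *\<^sub>C (x - y) = c *\<^sub>C x - c *\<^sub>C y" for x :: "'a::complex_hilbert_space"
  using scaleC_add_right[of c x "- y"] by (simp add: scaleC_minus_right)

section \<open>Riesz representation\<close>

lemma eq_if_cinner_eq:
  fixes y z :: "'a::complex_hilbert_space"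
  assumes "\<And>x. cinner x y = cinner x z"
  shows "y = z"
proof -
  have "cinner (y - z) (y - z) = 0"
    using assms by (simp add: cinner_diff_right)
  then show ?thesis by (simp add: cinner_self)
qed

text \<open>The representing vector minimises \<open>\<parallel>x\<parallel>\<^sup>2 - 2 f x\<close>; minimising
  sequences are Cauchy by the parallelogram law.\<close>

lemma riesz_real:
  fixes f :: "'a::complex_hilbert_space \<Rightarrow> real"
  assumes lin: "linear f" and bd: "\<And>x. \<bar>f x\<bar> \<le> K * norm x"
  shows "\<exists>z. \<forall>x. f x = Re (cinner x z)"
proof -
  define \<phi> where "\<phi> x = (norm x)\<^sup>2 - 2 * f x" for x
  have lower: "- K\<^sup>2 \<le> \<phi> x" for x
  proof -
    have "0 \<le> (norm x - K)\<^sup>2" by simp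
    also have "\<dots> = (norm x)\<^sup>2 - 2 * (K * norm x) + K\<^sup>2" by (simp add: power2_diff)
    also have "\<dots> \<le> \<phi> x + K\<^sup>2" using bd[of x] by (simp add: \<phi>_def abs_le_iff)
    finally show ?thesis by simp
  qed
  define m where "m = Inf (range \<phi>)"
  have bdd: "bdd_below (range \<phi>)" by (rule bdd_belowI[of _ "- K\<^sup>2"]) (use lower in auto)
  have m_le: "m \<le> \<phi> x" for x
    unfolding m_def by (rule cInf_lower[OF _ bdd]) simp
  have "\<exists>x. \<phi> x < m + 1 / real (Suc n)" for n
    using cInf_lessD[of "range \<phi>" "m + 1 / real (Suc n)"] by (auto simp: m_def)
  then obtain X where X: "\<And>n. \<phi> (X n) < m + 1 / real (Suc n)" by metis
  \<comment> \<open>By the parallelogram law the left side is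
    \<open>2 * \<phi> x + 2 * \<phi> y\<close> minus four times the value of \<open>\<phi>\<close>
    at the midpoint, and that value is at least \<open>m\<close>.\<close>
  have par: "(norm (x - y))\<^sup>2 \<le> 2 * (\<phi> x - m) + 2 * (\<phi> y - m)" for x y
  proof -
    have "(norm ((1/2) *\<^sub>R (x + y)))\<^sup>2 = (norm (x + y))\<^sup>2 / 4"
      by (simp add: power_mult_distrib power_divide)
    moreover have "f ((1/2) *\<^sub>R (x + y)) = (f x + f y) / 2"
      using lin by (simp add: linear_cmul linear_add)
    ultimately have "4 * m \<le> (norm (x + y))\<^sup>2 - 4 * (f x + f y)"
      using m_le[of "(1/2) *\<^sub>R (x + y)"] by (simp add: \<phi>_def)
    then show ?thesis by (simp add: \<phi>_def norm_add_sq norm_diff_sq)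
  qed
  have "Cauchy X"
  proof (rule metric_CauchyI)
    fix e :: real assume e: "0 < e"
    obtain n0 where n0: "4 / e\<^sup>2 < real n0" using reals_Archimedean2 by blast
    have "dist (X i) (X j) < e" if "i \<ge> n0" "j \<ge> n0" for i j
    proof -
      have small: "\<phi> (X k) - m < e\<^sup>2 / 4" if "k \<ge> n0" for k
      proof -
        have "4 / e\<^sup>2 < real (Suc k)" using n0 that by linarith
        then have "1 / real (Suc k) < e\<^sup>2 / 4" using e by (simp add: field_simps)
        then show ?thesis using X[of k] by linarith
      qed
      have "(norm (X i - X j))\<^sup>2 \<le> 2 * (\<phi> (X i) - m) + 2 * (\<phi> (X j) - m)"
        by (rule par)
      also have "\<dots> < 2 * (e\<^sup>2 / 4) + 2 * (e\<^sup>2 / 4)"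
        by (intro add_strict_mono mult_strict_left_mono small that) simp_all
      finally have "(norm (X i - X j))\<^sup>2 < e\<^sup>2" by simp
      then show ?thesis using e by (simp add: dist_norm power_less_imp_less_base)
    qed
    then show "\<exists>M. \<forall>i\<ge>M. \<forall>j\<ge>M. dist (X i) (X j) < e" by blast
  qed
  then obtain z where z: "X \<longlonglongrightarrow> z" using Cauchy_convergent convergent_def by blast
  have "bounded_linear f"
    using lin bd by (auto simp: bounded_linear_def bounded_linear_axioms_def mult.commute)
  then have "(\<lambda>n. f (X n)) \<longlonglongrightarrow> f z" using z by (rule bounded_linear.tendsto)
  then have "(\<lambda>n. \<phi> (X n)) \<longlonglongrightarrow> \<phi> z"
    unfolding \<phi>_def using z by (intro tendsto_diff tendsto_mult tendsto_power tendsto_norm tendsto_const)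
  moreover have "(\<lambda>n. m + 1 / real (Suc n)) \<longlonglongrightarrow> m"
    using tendsto_add[OF tendsto_const[of m] LIMSEQ_inverse_real_of_nat]
    by (simp add: inverse_eq_divide)
  ultimately have "\<phi> z \<le> m"
    by (rule LIMSEQ_le) (use X less_imp_le in blast)
  then have min: "\<phi> z \<le> \<phi> x" for x using m_le order_trans by blast
  have "f y = Re (cinner y z)" for y
  proof (cases "y = 0")
    case True
    then show ?thesis using lin by (simp add: linear_0 Re_cinner_commute[of 0])
  next
    case False
    define a where "a = Re (cinner y z) - f y"
    have "0 \<le> 2 * t * a + t\<^sup>2 * (norm y)\<^sup>2" for t
    proof -
      have "(norm (z + t *\<^sub>R y))\<^sup>2 = (norm z)\<^sup>2 + 2 * t * Re (cinner y z) + t\<^sup>2 * (norm y)\<^sup>2"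
        by (simp add: norm_add_sq cinner_scaleR_right power_mult_distrib Re_cinner_commute[of z y])
      then show ?thesis
        using min[of "z + t *\<^sub>R y"] lin
        by (simp add: \<phi>_def a_def linear_add linear_cmul algebra_simps)
    qed
    \<comment> \<open>This \<open>t\<close> minimises the quadratic; its value there is
      \<open>- a\<^sup>2 / (norm y)\<^sup>2\<close>, so nonnegativity forces
      \<open>a = 0\<close>.\<close>
    from this[of "- a / (norm y)\<^sup>2"] have "a\<^sup>2 / (norm y)\<^sup>2 \<le> 0"
      using False by (simp add: power2_eq_square field_simps)
    then have "a = 0" using False by (simp add: divide_le_0_iff)
    then show ?thesis by (simp add: a_def)
  qed
  then show ?thesis by blast
qed

text \<open>The real part of a complex-linear functional determines it: evaluated at
  \<open>\<i> *\<^sub>C x\<close> it returns minus the imaginary part at \<open>x\<close>. Hence the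
  vector that represents the real part represents \<open>f\<close>.\<close>

lemma riesz_complex:
  fixes f :: "'a::complex_hilbert_space \<Rightarrow> complex"
  assumes add: "\<And>x y. f (x + y) = f x + f y" and scale: "\<And>c x. f (c *\<^sub>C x) = c * f x"
    and bd: "\<And>x. \<bar>Re (f x)\<bar> \<le> K * norm x"
  shows "\<exists>z. \<forall>x. f x = cinner x z"
proof -
  have "linear (\<lambda>x. Re (f x))"
    by (rule linearI) (simp_all add: add scaleR_scaleC scale)
  from riesz_real[OF this bd] obtain z where z: "\<And>x. Re (f x) = Re (cinner x z)" by blast
  have "Im (f x) = Im (cinner x z)" for x
    using z[of "\<i> *\<^sub>C x"] by (simp add: scale cinner_scaleC_left)
  with z have "f x = cinner x z" for x by (simp add: complex_eq_iff)
  then show ?thesis by blast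
qed

section \<open>Bounded complex-linear operators\<close>

lemma bounded_clinearI:
  fixes T :: "'a::complex_hilbert_space \<Rightarrow> 'b::complex_hilbert_space"
  assumes "\<And>x y. T (x + y) = T x + T y" "\<And>c x. T (c *\<^sub>C x) = c *\<^sub>C T x"
    "\<And>x. norm (T x) \<le> K * norm x"
  shows "bounded_clinear T"
  unfolding bounded_clinear_def
  using assms by (auto intro!: bounded_linear_intro[of T K] simp: scaleR_scaleC mult.commute)

lemma
  assumes "bounded_clinear T"
  shows bounded_clinear_add: "T (x + y) = T x + T y"
    and bounded_clinear_diff: "T (x - y) = T x - T y"
    and bounded_clinear_zero: "T 0 = 0"
    and bounded_clinear_scaleC: "T (c *\<^sub>C x) = c *\<^sub>C T x"
    and bounded_clinear_scaleR: "T (r *\<^sub>R x) = r *\<^sub>R T x"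
  using assms unfolding bounded_clinear_def
  by (auto simp: linear_simps bounded_linear.linear linear_0)

lemma bounded_clinear_bound:
  assumes "bounded_clinear T"
  obtains K where "K > 0" "\<And>x. norm (T x) \<le> K * norm x"
  using assms bounded_linear.pos_bounded unfolding bounded_clinear_def
  by (metis mult.commute)

lemma bounded_clinear_comp:
  assumes "bounded_clinear S" "bounded_clinear T"
  shows "bounded_clinear (S \<circ> T)"
  using assms unfolding bounded_clinear_def
  by (auto simp: comp_def intro: bounded_linear_compose)

lemma bounded_clinear_id [simp]: "bounded_clinear id"
  by (rule bounded_clinearI[of _ 1]) auto

lemma bounded_clinear_zero_op [simp]: "bounded_clinear (\<lambda>_. 0)"
  by (rule bounded_clinearI[of _ 1]) auto

lemma bounded_clinear_scale_op [simp]: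
  "bounded_clinear (\<lambda>x. c *\<^sub>C x :: 'a::complex_hilbert_space)"
  by (rule bounded_clinearI[of _ "cmod c"])
    (simp_all add: scaleC_add_right scaleC_scaleC norm_scaleC mult.commute)

lemma bounded_clinear_add_op:
  assumes "bounded_clinear S" "bounded_clinear T"
  shows "bounded_clinear (\<lambda>x. S x + T x)"
  using assms unfolding bounded_clinear_def by (simp add: bounded_linear_add scaleC_add_right)

lemma bounded_clinear_minus_op:
  assumes "bounded_clinear T"
  shows "bounded_clinear (\<lambda>x. - T x)"
  using assms unfolding bounded_clinear_def by (simp add: bounded_linear_minus scaleC_minus_right)

lemma bounded_clinear_diff_op:
  assumes "bounded_clinear S" "bounded_clinear T"
  shows "bounded_clinear (\<lambda>x. S x - T x)"
  using assms unfolding bounded_clinear_def by (simp add: bounded_linear_sub scaleC_diff_right)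

section \<open>Adjoints\<close>

lemma cadjoint_unique:
  fixes T :: "'a::complex_hilbert_space \<Rightarrow> 'b::complex_hilbert_space"
  assumes "\<And>x y. cinner (T x) y = cinner x (S y)"
  shows "cadjoint T = S"
  unfolding cadjoint_def
proof (rule the_equality)
  show "S' = S" if "\<forall>x y. cinner (T x) y = cinner x (S' y)" for S'
    using that assms by (intro ext eq_if_cinner_eq) metis
qed (use assms in blast)

text \<open>Boundedness of \<open>T\<close> makes \<open>x \<mapsto> cinner (T x) y\<close> a
  bounded functional for each \<open>y\<close>. Riesz representation supplies an adjoint, and
  uniqueness identifies it with the definite description.\<close>

lemma cinner_cadjoint:
  fixes T :: "'a::complex_hilbert_space \<Rightarrow> 'b::complex_hilbert_space"
  assumes "bounded_clinear T"
  shows "cinner (T x) y = cinner x (cadjoint T y)"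
proof -
  obtain K where K: "K > 0" "\<And>x. norm (T x) \<le> K * norm x"
    using bounded_clinear_bound[OF assms] by blast
  have "\<exists>z. \<forall>x. cinner (T x) y = cinner x z" for y
  proof (rule riesz_complex[where K = "K * norm y"])
    show "\<bar>Re (cinner (T x) y)\<bar> \<le> K * norm y * norm x" for x
      using abs_Re_cinner_le[of "T x" y] mult_right_mono[OF K(2)[of x] norm_ge_zero[of y]]
      by (simp add: mult_ac)
  qed (simp_all add: assms bounded_clinear_add bounded_clinear_scaleC cinner_add_left
      cinner_scaleC_left)
  then obtain S where "\<And>x y. cinner (T x) y = cinner x (S y)" by metis
  with cadjoint_unique[of T S] show ?thesis by simp
qed

lemma cinner_cadjoint':
  fixes T :: "'a::complex_hilbert_space \<Rightarrow> 'b::complex_hilbert_space"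
  assumes "bounded_clinear T"
  shows "cinner (cadjoint T x) y = cinner x (T y)"
  by (metis assms cinner_cadjoint cinner_commute)

text \<open>The square of \<open>norm (cadjoint T x)\<close> is the real part of
  \<open>cinner (T (cadjoint T x)) x\<close>; one factor cancels after Cauchy-Schwarz.\<close>

lemma norm_cadjoint_le:
  fixes T :: "'a::complex_hilbert_space \<Rightarrow> 'b::complex_hilbert_space"
  assumes T: "bounded_clinear T" and K: "0 \<le> K" "\<And>x. norm (T x) \<le> K * norm x"
  shows "norm (cadjoint T x) \<le> K * norm x"
proof -
  let ?y = "cadjoint T x"
  have "(norm ?y)\<^sup>2 = Re (cinner (T ?y) x)" by (simp add: norm_sq_cinner cinner_cadjoint[OF T])
  also have "\<dots> \<le> norm (T ?y) * norm x" by (rule Re_cinner_le)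
  also have "\<dots> \<le> K * norm ?y * norm x" by (intro mult_right_mono K) simp
  finally show ?thesis
    by (cases "?y = 0") (use K in \<open>simp_all add: power2_eq_square mult_ac\<close>)
qed

lemma bounded_clinear_cadjoint:
  fixes T :: "'a::complex_hilbert_space \<Rightarrow> 'b::complex_hilbert_space"
  assumes T: "bounded_clinear T"
  shows "bounded_clinear (cadjoint T)"
proof -
  obtain K where K: "K > 0" "\<And>x. norm (T x) \<le> K * norm x"
    using bounded_clinear_bound[OF T] by blast
  note adj = cinner_cadjoint[OF T, symmetric]
  show ?thesis
  proof (rule bounded_clinearI[of _ K])
    fix x y
    show "cadjoint T (x + y) = cadjoint T x + cadjoint T y"
      by (rule eq_if_cinner_eq) (simp add: adj cinner_add_right)
    show "cadjoint T (c *\<^sub>C x) = c *\<^sub>C cadjoint T x" for c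
      by (rule eq_if_cinner_eq) (simp add: adj cinner_scaleC_right)
    show "norm (cadjoint T x) \<le> K * norm x"
      using K by (intro norm_cadjoint_le[OF T]) auto
  qed
qed

lemma cadjoint_cadjoint:
  fixes T :: "'a::complex_hilbert_space \<Rightarrow> 'b::complex_hilbert_space"
  assumes "bounded_clinear T"
  shows "cadjoint (cadjoint T) = T"
  by (rule cadjoint_unique) (simp add: assms cinner_cadjoint')

lemma cadjoint_comp:
  fixes S :: "'b::complex_hilbert_space \<Rightarrow> 'c::complex_hilbert_space"
    and T :: "'a::complex_hilbert_space \<Rightarrow> 'b"
  assumes "bounded_clinear S" "bounded_clinear T"
  shows "cadjoint (S \<circ> T) = cadjoint T \<circ> cadjoint S"
  by (rule cadjoint_unique) (simp add: assms cinner_cadjoint)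

lemma cadjoint_add:
  fixes S T :: "'a::complex_hilbert_space \<Rightarrow> 'b::complex_hilbert_space"
  assumes "bounded_clinear S" "bounded_clinear T"
  shows "cadjoint (\<lambda>x. S x + T x) = (\<lambda>x. cadjoint S x + cadjoint T x)"
  by (rule cadjoint_unique) (simp add: assms cinner_cadjoint cinner_add_left cinner_add_right)

lemma cadjoint_diff:
  fixes S T :: "'a::complex_hilbert_space \<Rightarrow> 'b::complex_hilbert_space"
  assumes "bounded_clinear S" "bounded_clinear T"
  shows "cadjoint (\<lambda>x. S x - T x) = (\<lambda>x. cadjoint S x - cadjoint T x)"
  by (rule cadjoint_unique) (simp add: assms cinner_cadjoint cinner_diff_left cinner_diff_right)

lemma cadjoint_id: "cadjoint id = (id :: 'a::complex_hilbert_space \<Rightarrow> 'a)"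
  by (rule cadjoint_unique) simp

subsection \<open>Compact operators and the Calkin algebra\<close>

text \<open>\<open>G y\<close> is the fixed point of the contraction
  \<open>\<lambda>x. y + A x\<close>, so no series is summed; linearity of \<open>G\<close> comes
  from uniqueness of the fixed point.\<close>

lemma neumann_inverse:
  fixes A :: "'a::complex_hilbert_space \<Rightarrow> 'a"
  assumes A: "bounded_clinear A" and q: "0 \<le> q" "q < 1" and le: "\<And>x. norm (A x) \<le> q * norm x"
  obtains G where "bounded_clinear G" "\<And>x. G x - A (G x) = x" "\<And>x. G (x - A x) = x"
proof -
  have "\<exists>!x. y + A x = x" for y
  proof (rule banach_fix_type[OF q], intro allI)
    fix x x'
    have "dist (y + A x) (y + A x') = norm (A (x - x'))"
      by (simp add: dist_norm bounded_clinear_diff[OF A])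
    also have "\<dots> \<le> q * dist x x'" using le by (simp add: dist_norm)
    finally show "dist (y + A x) (y + A x') \<le> q * dist x x'" .
  qed
  then obtain G where G: "\<And>y. y + A (G y) = G y" and uniq: "\<And>x y. y + A x = x \<Longrightarrow> x = G y"
    by metis
  have "bounded_clinear G"
  proof (rule bounded_clinearI[of _ "1 / (1 - q)"])
    fix x y
    show "G (x + y) = G x + G y"
      using G[of x] G[of y] by (intro uniq[symmetric]) (simp add: bounded_clinear_add[OF A] add_ac)
    show "G (c *\<^sub>C x) = c *\<^sub>C G x" for c
      using arg_cong[OF G[of x], of "\<lambda>v. c *\<^sub>C v"]
      by (intro uniq[symmetric]) (simp add: bounded_clinear_scaleC[OF A] scaleC_add_right)
    have "norm (G x) \<le> norm x + q * norm (G x)"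
      using G[of x] norm_triangle_ineq[of x "A (G x)"] le[of "G x"] by simp
    then show "norm (G x) \<le> 1 / (1 - q) * norm x"
      using q by (simp add: field_simps)
  qed
  moreover have "G x - A (G x) = x" for x
    using G[of x] by (simp add: diff_eq_eq)
  moreover have "G (x - A x) = x" for x
    by (rule uniq[symmetric]) simp
  ultimately show ?thesis using that by blast
qed

text \<open>The sequential form makes the ideal properties and the C*-identity arguments about
  subsequences. Forwards, a bounded sequence is scaled into the unit ball.\<close>

lemma compact_operators_iff:
  "T \<in> compact_operators \<longleftrightarrow> bounded_clinear T \<and>
    (\<forall>X. bounded (range X) \<longrightarrow> (\<exists>r::nat\<Rightarrow>nat. strict_mono r \<and> convergent (\<lambda>n. T (X (r n)))))"
  (is "_ \<longleftrightarrow> _ \<and> ?seq")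
proof (intro iffI conjI)
  assume T: "T \<in> compact_operators"
  then show lin: "bounded_clinear T" by (simp add: compact_operators_def)
  show ?seq
  proof (intro allI impI)
    fix X :: "nat \<Rightarrow> 'a" assume "bounded (range X)"
    then obtain B where B: "B > 0" "\<And>n. norm (X n) \<le> B" by (auto simp: bounded_pos)
    have "T ((1/B) *\<^sub>R X n) \<in> closure (T ` cball 0 1)" for n
      using B by (intro subsetD[OF closure_subset] imageI) (simp add: divide_le_eq)
    moreover have "compact (closure (T ` cball 0 1))" using T by (simp add: compact_operators_def)
    ultimately obtain l r where r: "strict_mono (r :: nat \<Rightarrow> nat)"
      and l: "((\<lambda>n. T ((1/B) *\<^sub>R X n)) \<circ> r) \<longlonglongrightarrow> l"
      unfolding compact_def by metis
    have "(\<lambda>n. B *\<^sub>R T ((1/B) *\<^sub>R X (r n))) \<longlonglongrightarrow> B *\<^sub>R l"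
      using l by (intro tendsto_scaleR tendsto_const) (simp add: comp_def)
    then have "convergent (\<lambda>n. T (X (r n)))"
      using B by (auto simp: bounded_clinear_scaleR[OF lin] convergent_def)
    with r show "\<exists>r::nat\<Rightarrow>nat. strict_mono r \<and> convergent (\<lambda>n. T (X (r n)))" by blast
  qed
next
  assume *: "bounded_clinear T \<and> ?seq"
  have "compact (closure (T ` cball 0 1))"
    unfolding compact_def
  proof (intro allI impI)
    fix y :: "nat \<Rightarrow> 'a" assume y: "\<forall>n. y n \<in> closure (T ` cball 0 1)"
    \<comment> \<open>Points of the closure need not be images, so \<open>y n\<close> is replaced by
      an image \<open>T (x n)\<close> whose distance from it tends to zero; this leaves limits of
      subsequences unchanged.\<close>
    have "\<exists>x. norm x \<le> 1 \<and> dist (T x) (y n) < 1 / real (Suc n)" for n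
      using y closure_approachable[of "y n" "T ` cball 0 1"]
      by (auto dest!: spec[of _ "1 / real (Suc n)"])
    then obtain x where x: "\<And>n. norm (x n) \<le> 1" "\<And>n. dist (T (x n)) (y n) < 1 / real (Suc n)"
      by metis
    have "bounded (range x)" using x(1) by (auto simp: bounded_iff)
    with * obtain r l where r: "strict_mono (r :: nat \<Rightarrow> nat)" and l: "(\<lambda>n. T (x (r n))) \<longlonglongrightarrow> l"
      unfolding convergent_def by blast
    have "(\<lambda>n. y n - T (x n)) \<longlonglongrightarrow> 0"
    proof (rule Lim_null_comparison[OF _ LIMSEQ_inverse_real_of_nat])
      show "\<forall>\<^sub>F n in sequentially. norm (y n - T (x n)) \<le> inverse (real (Suc n))"
        using x(2) by (intro always_eventually allI)
          (simp add: dist_norm norm_minus_commute inverse_eq_divide less_imp_le)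
    qed
    from LIMSEQ_subseq_LIMSEQ[OF this r] have "(\<lambda>n. y (r n) - T (x (r n))) \<longlonglongrightarrow> 0"
      by (simp add: comp_def)
    from tendsto_add[OF this l] have "(y \<circ> r) \<longlonglongrightarrow> l" by (simp add: comp_def)
    moreover have "l \<in> closure (T ` cball 0 1)"
      using y by (intro closed_sequentially[OF closed_closure _ calculation]) simp
    ultimately show "\<exists>l\<in>closure (T ` cball 0 1). \<exists>r. strict_mono r \<and> (y \<circ> r) \<longlonglongrightarrow> l"
      using r by blast
  qed
  with * show "T \<in> compact_operators" by (simp add: compact_operators_def)
qed

lemma compact_operators_bounded: "T \<in> compact_operators \<Longrightarrow> bounded_clinear T"
  by (simp add: compact_operators_def)

lemma compact_operatorsD:
  assumes "T \<in> compact_operators" "bounded (range X)"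
  obtains r :: "nat \<Rightarrow> nat" where "strict_mono r" "convergent (\<lambda>n. T (X (r n)))"
  using assms unfolding compact_operators_iff by blast

lemma bounded_range_image:
  assumes "bounded_clinear T" "bounded (range X)"
  shows "bounded (range (\<lambda>n. T (X n)))"
  using bounded_linear_image[OF assms(2), of T] assms(1)
  by (simp add: bounded_clinear_def image_image)

lemma bounded_range_subseq: "bounded (range X) \<Longrightarrow> bounded (range (\<lambda>n. X (r n)))"
  by (rule bounded_subset) auto

lemma convergent_image:
  assumes "bounded_clinear T" "convergent X"
  shows "convergent (\<lambda>n. T (X n))"
  using assms bounded_linear.tendsto unfolding bounded_clinear_def convergent_def by metis

lemma compact_operators_comp_left:
  fixes S :: "'a::complex_hilbert_space \<Rightarrow> 'a"
  assumes "bounded_clinear S" "T \<in> compact_operators"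
  shows "S \<circ> T \<in> compact_operators"
  unfolding compact_operators_iff
proof (intro conjI allI impI)
  fix X :: "nat \<Rightarrow> 'a" assume "bounded (range X)"
  from compact_operatorsD[OF assms(2) this]
  obtain r :: "nat \<Rightarrow> nat" where r: "strict_mono r" "convergent (\<lambda>n. T (X (r n)))" .
  from convergent_image[OF assms(1) r(2)] r(1)
  show "\<exists>r::nat\<Rightarrow>nat. strict_mono r \<and> convergent (\<lambda>n. (S \<circ> T) (X (r n)))" by auto
qed (use assms compact_operators_bounded bounded_clinear_comp in blast)

lemma compact_operators_comp_right:
  fixes S :: "'a::complex_hilbert_space \<Rightarrow> 'a"
  assumes "bounded_clinear S" "T \<in> compact_operators"
  shows "T \<circ> S \<in> compact_operators"
  unfolding compact_operators_iff
proof (intro conjI allI impI)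
  fix X :: "nat \<Rightarrow> 'a" assume "bounded (range X)"
  from compact_operatorsD[OF assms(2) bounded_range_image[OF assms(1) this]]
  show "\<exists>r::nat\<Rightarrow>nat. strict_mono r \<and> convergent (\<lambda>n. (T \<circ> S) (X (r n)))" by auto
qed (use assms compact_operators_bounded bounded_clinear_comp in blast)

lemma compact_operators_add:
  fixes S T :: "'a::complex_hilbert_space \<Rightarrow> 'a"
  assumes "S \<in> compact_operators" "T \<in> compact_operators"
  shows "(\<lambda>x. S x + T x) \<in> compact_operators"
  unfolding compact_operators_iff
proof (intro conjI allI impI)
  fix X :: "nat \<Rightarrow> 'a" assume X: "bounded (range X)"
  from compact_operatorsD[OF assms(1) X]
  obtain r :: "nat \<Rightarrow> nat" where r: "strict_mono r" "convergent (\<lambda>n. S (X (r n)))" .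
  from compact_operatorsD[OF assms(2) bounded_range_subseq[OF X]]
  obtain p :: "nat \<Rightarrow> nat" where p: "strict_mono p" "convergent (\<lambda>n. T (X (r (p n))))" .
  have "convergent (\<lambda>n. S (X (r (p n))))"
    using convergent_subseq_convergent[OF r(2) p(1)] by (simp add: comp_def)
  from convergent_add[OF this p(2)] strict_mono_o[OF r(1) p(1)]
  show "\<exists>r::nat\<Rightarrow>nat. strict_mono r \<and> convergent (\<lambda>n. S (X (r n)) + T (X (r n)))"
    by (auto simp: comp_def)
qed (use assms compact_operators_bounded bounded_clinear_add_op in blast)

lemma compact_operators_minus:
  fixes T :: "'a::complex_hilbert_space \<Rightarrow> 'a"
  assumes "T \<in> compact_operators"
  shows "(\<lambda>x. - T x) \<in> compact_operators"
  using compact_operators_comp_left[OF bounded_clinear_minus_op[OF bounded_clinear_id] assms]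
  by (simp add: comp_def)

lemma compact_operators_zero: "(\<lambda>_. 0) \<in> compact_operators"
  unfolding compact_operators_iff using strict_mono_id by (auto intro: convergent_const)

text \<open>If \<open>A\<^sup>* A x\<^sub>n\<close> is Cauchy along a bounded sequence then so is \<open>A x\<^sub>n\<close>, because
  \<open>\<parallel>A x\<parallel>\<^sup>2 = \<langle>A\<^sup>* A x, x\<rangle>\<close>.\<close>

lemma compact_operators_cstar:
  fixes A :: "'a::complex_hilbert_space \<Rightarrow> 'a"
  assumes A: "bounded_clinear A" and AA: "cadjoint A \<circ> A \<in> compact_operators"
  shows "A \<in> compact_operators"
  unfolding compact_operators_iff
proof (intro conjI allI impI A)
  fix X :: "nat \<Rightarrow> 'a" assume X: "bounded (range X)"
  then obtain B where B: "B > 0" "\<And>n. norm (X n) \<le> B" by (auto simp: bounded_pos)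
  let ?B = "cadjoint A \<circ> A"
  from compact_operatorsD[OF AA X]
  obtain r :: "nat \<Rightarrow> nat" where r: "strict_mono r" and conv: "convergent (\<lambda>n. ?B (X (r n)))" .
  have "Cauchy (\<lambda>n. A (X (r n)))"
  proof (rule metric_CauchyI)
    fix e :: real assume e: "0 < e"
    have "0 < e\<^sup>2 / (2 * B)" using e B by simp
    from metric_CauchyD[OF convergent_Cauchy[OF conv] this] obtain M where
      M: "\<And>i j. i \<ge> M \<Longrightarrow> j \<ge> M \<Longrightarrow> dist (?B (X (r i))) (?B (X (r j))) < e\<^sup>2 / (2 * B)"
      by blast
    have "dist (A (X (r i))) (A (X (r j))) < e" if ij: "i \<ge> M" "j \<ge> M" for i j
    proof -
      define v where "v = X (r i) - X (r j)"
      have v: "norm v \<le> 2 * B"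
        using norm_triangle_ineq4[of "X (r i)" "X (r j)"] B(2)[of "r i"] B(2)[of "r j"]
        by (simp add: v_def)
      have "?B v = ?B (X (r i)) - ?B (X (r j))"
        by (simp add: v_def bounded_clinear_diff[OF A]
            bounded_clinear_diff[OF bounded_clinear_cadjoint[OF A]])
      then have Bv: "norm (?B v) < e\<^sup>2 / (2 * B)" using M[OF ij] by (simp add: dist_norm)
      have "(norm (A v))\<^sup>2 = Re (cinner (?B v) v)"
        by (simp add: norm_sq_cinner cinner_cadjoint'[OF A])
      also have "\<dots> \<le> norm (?B v) * norm v" by (rule Re_cinner_le)
      also have "\<dots> \<le> norm (?B v) * (2 * B)" using v by (intro mult_left_mono) auto
      also have "\<dots> < e\<^sup>2 / (2 * B) * (2 * B)" using Bv B by (intro mult_strict_right_mono) auto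
      also have "\<dots> = e\<^sup>2" using B by simp
      finally have "norm (A v) < e" using e by (auto intro: power_less_imp_less_base)
      then show ?thesis by (simp add: v_def dist_norm bounded_clinear_diff[OF A])
    qed
    then show "\<exists>M. \<forall>i\<ge>M. \<forall>j\<ge>M. dist (A (X (r i))) (A (X (r j))) < e" by blast
  qed
  with r show "\<exists>r::nat\<Rightarrow>nat. strict_mono r \<and> convergent (\<lambda>n. A (X (r n)))"
    using Cauchy_convergent by blast
qed

text \<open>\<open>A \<circ> cadjoint A\<close> is compact by the ideal property, and it is the
  product to which \<open>compact_operators_cstar\<close> refers when applied to
  \<open>cadjoint A\<close>.\<close>

lemma compact_operators_cadjoint:
  fixes A :: "'a::complex_hilbert_space \<Rightarrow> 'a"
  assumes "A \<in> compact_operators"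
  shows "cadjoint A \<in> compact_operators"
proof -
  have A: "bounded_clinear A" by (rule compact_operators_bounded[OF assms])
  show ?thesis
    using compact_operators_cstar[OF bounded_clinear_cadjoint[OF A]]
      compact_operators_comp_right[OF bounded_clinear_cadjoint[OF A] assms]
    by (simp add: cadjoint_cadjoint[OF A])
qed

section \<open>The operator ring and its quotient\<close>

lemma operator_ring_simps:
  "carrier operator_ring = {T. bounded_clinear T}"
  "S \<otimes>\<^bsub>operator_ring\<^esub> T = S \<circ> T"
  "S \<oplus>\<^bsub>operator_ring\<^esub> T = (\<lambda>x. S x + T x)"
  "\<one>\<^bsub>operator_ring\<^esub> = id"
  "\<zero>\<^bsub>operator_ring\<^esub> = (\<lambda>_. 0)"
  by (simp_all add: operator_ring_def)

lemma ring_operator_ring: "ring (operator_ring :: ('a::complex_hilbert_space \<Rightarrow> 'a) ring)"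
proof (rule ringI)
  show "abelian_group (operator_ring :: ('a \<Rightarrow> 'a) ring)"
  proof (rule abelian_groupI)
    show "\<exists>S\<in>carrier operator_ring. S \<oplus>\<^bsub>operator_ring\<^esub> T = \<zero>\<^bsub>operator_ring\<^esub>"
      if "T \<in> carrier operator_ring" for T :: "'a \<Rightarrow> 'a"
      using that bounded_clinear_minus_op
      by (intro bexI[of _ "\<lambda>x. - T x"]) (auto simp: operator_ring_simps)
  qed (auto simp: operator_ring_simps bounded_clinear_add_op add_ac)
  show "monoid (operator_ring :: ('a \<Rightarrow> 'a) ring)"
    by (rule monoidI) (auto simp: operator_ring_simps bounded_clinear_comp)
qed (auto simp: operator_ring_simps bounded_clinear_add)

lemma operator_ring_a_inv:
  fixes T :: "'a::complex_hilbert_space \<Rightarrow> 'a"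
  assumes "bounded_clinear T"
  shows "\<ominus>\<^bsub>operator_ring\<^esub> T = (\<lambda>x. - T x)"
proof -
  interpret ring "operator_ring :: ('a \<Rightarrow> 'a) ring" by (rule ring_operator_ring)
  show ?thesis
    using assms bounded_clinear_minus_op[OF assms]
    by (intro minus_equality) (auto simp: operator_ring_simps)
qed

lemma ideal_compact_operators:
  "ideal (compact_operators :: ('a::complex_hilbert_space \<Rightarrow> 'a) set) operator_ring"
proof (rule idealI[OF ring_operator_ring])
  interpret ring "operator_ring :: ('a \<Rightarrow> 'a) ring" by (rule ring_operator_ring)
  show "subgroup (compact_operators :: ('a \<Rightarrow> 'a) set) (add_monoid operator_ring)"
  proof (rule add.subgroupI)
    show "\<ominus>\<^bsub>operator_ring\<^esub> T \<in> compact_operators" if "T \<in> compact_operators" for T :: "'a \<Rightarrow> 'a"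
      using that by (simp add: operator_ring_a_inv compact_operators_bounded compact_operators_minus)
  qed (use compact_operators_zero compact_operators_add compact_operators_bounded
      in \<open>auto simp: operator_ring_simps\<close>)
qed (auto simp: operator_ring_simps compact_operators_comp_left compact_operators_comp_right)

lemma calkin_proj_hom:
  "ring_hom_ring operator_ring calkin_algebra
    (calkin_proj :: ('a::complex_hilbert_space \<Rightarrow> 'a) \<Rightarrow> _)"
  using ideal.rcos_ring_hom_ring[OF ideal_compact_operators]
  unfolding calkin_algebra_def calkin_proj_def[abs_def] .

lemma ring_calkin_algebra:
  "ring (calkin_algebra :: ('a::complex_hilbert_space \<Rightarrow> 'a) set ring)"
  by (rule ring_hom_ring.axioms(2)[OF calkin_proj_hom])

lemma calkin_proj_eq_iff:
  fixes S T :: "'a::complex_hilbert_space \<Rightarrow> 'a"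
  assumes "bounded_clinear S" "bounded_clinear T"
  shows "calkin_proj S = calkin_proj T \<longleftrightarrow> (\<lambda>x. S x - T x) \<in> compact_operators"
proof -
  interpret ideal "compact_operators :: ('a \<Rightarrow> 'a) set" operator_ring
    by (rule ideal_compact_operators)
  have "calkin_proj S = calkin_proj T \<longleftrightarrow> S \<ominus>\<^bsub>operator_ring\<^esub> T \<in> compact_operators"
    using assms unfolding calkin_proj_def
    by (intro quotient_eq_iff_same_a_r_cos[symmetric] ideal_compact_operators)
      (auto simp: operator_ring_simps)
  then show ?thesis
    by (simp add: a_minus_def operator_ring_a_inv assms operator_ring_simps)
qed

lemma carrier_calkin_algebra:
  "carrier (calkin_algebra :: ('a::complex_hilbert_space \<Rightarrow> 'a) set ring)
    = calkin_proj ` {T. bounded_clinear T}"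
  by (auto simp: calkin_algebra_def FactRing_def A_RCOSETS_def' calkin_proj_def operator_ring_simps)

text \<open>Adjunction is additive, and as an involution that preserves compactness it maps the
  compact operators onto themselves; so it carries cosets to cosets.\<close>

lemma calkin_star_proj:
  fixes T :: "'a::complex_hilbert_space \<Rightarrow> 'a"
  assumes T: "bounded_clinear T"
  shows "calkin_star (calkin_proj T) = calkin_proj (cadjoint T)"
proof -
  have eq: "calkin_proj S = (\<lambda>K x. K x + S x) ` compact_operators" for S :: "'a \<Rightarrow> 'a"
    by (auto simp: calkin_proj_def a_r_coset_def' operator_ring_simps)
  have "cadjoint (\<lambda>x. K x + T x) = (\<lambda>x. cadjoint K x + cadjoint T x)"
    if "K \<in> compact_operators" for K
    using that T by (simp add: cadjoint_add compact_operators_bounded)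
  then have "calkin_star (calkin_proj T) = (\<lambda>K x. K x + cadjoint T x) ` cadjoint ` compact_operators"
    by (simp add: calkin_star_def eq image_image cong: image_cong)
  also have "cadjoint ` compact_operators = (compact_operators :: ('a \<Rightarrow> 'a) set)"
  proof
    show "compact_operators \<subseteq> cadjoint ` (compact_operators :: ('a \<Rightarrow> 'a) set)"
    proof
      fix K :: "'a \<Rightarrow> 'a" assume "K \<in> compact_operators"
      then show "K \<in> cadjoint ` compact_operators"
        by (intro image_eqI[of _ _ "cadjoint K"])
          (simp_all add: compact_operators_cadjoint cadjoint_cadjoint compact_operators_bounded)
    qed
  qed (auto simp: compact_operators_cadjoint)
  finally show ?thesis by (simp add: eq)
qed

text \<open>As a type, the Calkin algebra is accessible to the ring simplification rules. The class is not
  \<open>ring_1\<close>, since \<open>1 = 0\<close> when the space is finite-dimensional.\<close>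

typedef (overloaded) 'a calkin =
  "carrier (calkin_algebra :: ('a::complex_hilbert_space \<Rightarrow> 'a) set ring)"
  unfolding carrier_calkin_algebra using bounded_clinear_id by blast

setup_lifting type_definition_calkin

instantiation calkin :: (complex_hilbert_space) "{ring, monoid_mult}"
begin

lift_definition zero_calkin :: "'a calkin" is "\<zero>\<^bsub>calkin_algebra\<^esub>"
  by (rule ring.ring_simprules(2)[OF ring_calkin_algebra])

lift_definition one_calkin :: "'a calkin" is "\<one>\<^bsub>calkin_algebra\<^esub>"
  by (rule ring.ring_simprules(6)[OF ring_calkin_algebra])

lift_definition plus_calkin :: "'a calkin \<Rightarrow> 'a calkin \<Rightarrow> 'a calkin" is "add calkin_algebra"
  by (rule ring.ring_simprules(1)[OF ring_calkin_algebra])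

lift_definition times_calkin :: "'a calkin \<Rightarrow> 'a calkin \<Rightarrow> 'a calkin" is "mult calkin_algebra"
  by (rule ring.ring_simprules(5)[OF ring_calkin_algebra])

lift_definition uminus_calkin :: "'a calkin \<Rightarrow> 'a calkin" is "a_inv calkin_algebra"
  by (rule ring.ring_simprules(3)[OF ring_calkin_algebra])

lift_definition minus_calkin :: "'a calkin \<Rightarrow> 'a calkin \<Rightarrow> 'a calkin" is "a_minus calkin_algebra"
  by (rule ring.ring_simprules(4)[OF ring_calkin_algebra])

instance
proof
  interpret ring_hom_ring operator_ring calkin_algebra "calkin_proj :: ('a \<Rightarrow> 'a) \<Rightarrow> _"
    by (rule calkin_proj_hom)
  fix a b c :: "'a calkin"
  show "a + b + c = a + (b + c)" by transfer (simp add: S.a_assoc)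
  show "a + b = b + a" by transfer (simp add: S.a_comm)
  show "0 + a = a" by transfer simp
  show "- a + a = 0" by transfer (simp add: S.l_neg)
  show "a - b = a + - b" by transfer (simp add: a_minus_def)
  show "a * b * c = a * (b * c)" by transfer (simp add: S.m_assoc)
  show "(a + b) * c = a * c + b * c" by transfer (simp add: S.l_distr)
  show "a * (b + c) = a * b + a * c" by transfer (simp add: S.r_distr)
  show "1 * a = a" "a * 1 = a" by (transfer, simp)+
qed

end

section \<open>Classes of operators in the Calkin algebra\<close>

definition calk :: "('a::complex_hilbert_space \<Rightarrow> 'a) \<Rightarrow> 'a calkin" where
  "calk T = Abs_calkin (calkin_proj T)"

lemma Rep_calk: "bounded_clinear T \<Longrightarrow> Rep_calkin (calk T) = calkin_proj T"
  by (simp add: calk_def Abs_calkin_inverse carrier_calkin_algebra)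

lemma calk_eq_iff:
  assumes "bounded_clinear S" "bounded_clinear T"
  shows "calk S = calk T \<longleftrightarrow> calkin_proj S = calkin_proj T"
  using assms by (metis Rep_calk calk_def)

lemma
  fixes S T :: "'a::complex_hilbert_space \<Rightarrow> 'a"
  assumes S: "bounded_clinear S" and T: "bounded_clinear T"
  shows calk_comp: "calk (S \<circ> T) = calk S * calk T"
    and calk_diff: "calk (\<lambda>x. S x - T x) = calk S - calk T"
proof -
  interpret ring_hom_ring operator_ring calkin_algebra "calkin_proj :: ('a \<Rightarrow> 'a) \<Rightarrow> _"
    by (rule calkin_proj_hom)
  have car: "S \<in> carrier operator_ring" "T \<in> carrier operator_ring"
    using S T by (simp_all add: operator_ring_simps)
  have "Rep_calkin (calk (S \<circ> T)) = Rep_calkin (calk S * calk T)"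
    using hom_mult[OF car] S T
    by (simp add: Rep_calk bounded_clinear_comp times_calkin.rep_eq operator_ring_simps)
  then show "calk (S \<circ> T) = calk S * calk T" by (simp add: Rep_calkin_inject)
  have add: "calk (\<lambda>x. A x + B x) = calk A + calk B"
    if "bounded_clinear A" "bounded_clinear B" for A B :: "'a \<Rightarrow> 'a"
  proof -
    have "Rep_calkin (calk (\<lambda>x. A x + B x)) = Rep_calkin (calk A + calk B)"
      using hom_add[of A B] that
      by (simp add: Rep_calk bounded_clinear_add_op plus_calkin.rep_eq operator_ring_simps)
    then show ?thesis by (simp add: Rep_calkin_inject)
  qed
  from add[OF bounded_clinear_diff_op[OF S T] T] show "calk (\<lambda>x. S x - T x) = calk S - calk T"
    by (simp add: eq_diff_eq)
qed

lemma calk_id: "calk id = 1"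
proof -
  interpret ring_hom_ring operator_ring calkin_algebra "calkin_proj :: ('a \<Rightarrow> 'a) \<Rightarrow> _"
    by (rule calkin_proj_hom)
  have "Rep_calkin (calk id) = Rep_calkin (1 :: 'a calkin)"
    using hom_one by (simp add: Rep_calk one_calkin.rep_eq operator_ring_simps)
  then show ?thesis by (simp add: Rep_calkin_inject)
qed

lemma calk_eq_0_iff:
  assumes T: "bounded_clinear T"
  shows "calk T = 0 \<longleftrightarrow> T \<in> compact_operators"
proof -
  have "calk (\<lambda>x. T x - T x) = 0" using calk_diff[OF T T] by simp
  then have "calk T = 0 \<longleftrightarrow> calk T = calk (\<lambda>_. 0)" by simp
  also have "\<dots> \<longleftrightarrow> T \<in> compact_operators"
    using T by (simp add: calk_eq_iff calkin_proj_eq_iff)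
  finally show ?thesis .
qed

text \<open>This weak form of the C*-identity replaces the quotient norm, which is never introduced;
  it reduces to \<open>compact_operators_cstar\<close>.\<close>

lemma calk_cstar:
  fixes A :: "'a::complex_hilbert_space \<Rightarrow> 'a"
  assumes A: "bounded_clinear A" and "calk (cadjoint A) * calk A = 0"
  shows "calk A = 0"
proof -
  have "calk (cadjoint A \<circ> A) = 0"
    using assms by (simp add: calk_comp bounded_clinear_cadjoint)
  then show ?thesis
    using A compact_operators_cstar[OF A]
    by (simp add: calk_eq_0_iff bounded_clinear_comp bounded_clinear_cadjoint)
qed

lemma essentially_normal_iff:
  fixes T :: "'a::complex_hilbert_space \<Rightarrow> 'a"
  assumes T: "bounded_clinear T"
  shows "essentially_normal T \<longleftrightarrow> calk (cadjoint T) * calk T = calk T * calk (cadjoint T)"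
  unfolding essentially_normal_def
  using T by (simp add: calkin_star_proj Rep_calk bounded_clinear_cadjoint times_calkin.rep_eq
      Rep_calkin_inject[symmetric])

text \<open>Turns membership in \<open>Units\<close> into equations in the type
  \<open>'a calkin\<close>, to which the ring identities below apply.\<close>

lemma not_in_essential_spectrum_iff:
  fixes T :: "'a::complex_hilbert_space \<Rightarrow> 'a"
  assumes T: "bounded_clinear T"
  shows "z \<notin> essential_spectrum T \<longleftrightarrow>
    (\<exists>s. s * (calk (\<lambda>x. z *\<^sub>C x) - calk T) = 1 \<and> (calk (\<lambda>x. z *\<^sub>C x) - calk T) * s = 1)"
proof -
  define c :: "'a calkin" where "c = calk (\<lambda>x. z *\<^sub>C x) - calk T"
  have c: "Rep_calkin c = calkin_proj (\<lambda>x. z *\<^sub>C x) \<ominus>\<^bsub>calkin_algebra\<^esub> calkin_proj T"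
    by (simp add: c_def minus_calkin.rep_eq Rep_calk T)
  have "z \<notin> essential_spectrum T \<longleftrightarrow> Rep_calkin c \<in> Units calkin_algebra"
    by (simp add: essential_spectrum_def calkin_spectrum_def c)
  also have "\<dots> \<longleftrightarrow> (\<exists>s. s * c = 1 \<and> c * s = 1)"
    unfolding Units_def by transfer auto
  finally show ?thesis by (simp add: c_def)
qed

lemma calk_cases: obtains T where "bounded_clinear T" "a = calk T"
proof -
  have "Rep_calkin a \<in> calkin_proj ` {T. bounded_clinear T}"
    using Rep_calkin[of a] by (simp add: carrier_calkin_algebra)
  then obtain T where "bounded_clinear T" "Rep_calkin a = calkin_proj T" by auto
  with that show ?thesis by (metis Rep_calkin_inverse calk_def)
qed

text \<open>The type \<open>'a calkin\<close> carries only a ring structure, so scalars enter as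
  classes of scalar operators.\<close>

abbreviation calk_scalar :: "complex \<Rightarrow> 'a::complex_hilbert_space calkin" where
  "calk_scalar z \<equiv> calk (\<lambda>x. z *\<^sub>C x)"

lemma calk_scaleC:
  assumes "bounded_clinear T"
  shows "calk (\<lambda>x. z *\<^sub>C T x) = calk_scalar z * calk T"
  using calk_comp[OF bounded_clinear_scale_op assms] by (simp add: comp_def)

lemma calk_scalar_central: "calk_scalar z * a = a * calk_scalar z"
proof -
  obtain T where T: "bounded_clinear T" "a = calk T" by (rule calk_cases)
  have "(\<lambda>x. z *\<^sub>C x) \<circ> T = T \<circ> (\<lambda>x. z *\<^sub>C x)"
    by (simp add: comp_def bounded_clinear_scaleC[OF T(1)])
  then show ?thesis
    by (simp add: T calk_comp[OF bounded_clinear_scale_op T(1), symmetric]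
        calk_comp[OF T(1) bounded_clinear_scale_op, symmetric])
qed

lemma calk_scalar_mult: "calk_scalar z * calk_scalar w = calk_scalar (z * w)"
  by (simp add: calk_comp[symmetric] comp_def scaleC_scaleC)

lemma calk_ident: "calk (\<lambda>x. x) = 1"
  by (simp add: calk_id[symmetric] id_def)

lemma calk_neumann:
  fixes A :: "'a::complex_hilbert_space \<Rightarrow> 'a"
  assumes A: "bounded_clinear A" and "0 \<le> q" "q < 1" "\<And>x. norm (A x) \<le> q * norm x"
  obtains g where "g * (1 - calk A) = 1" "(1 - calk A) * g = 1"
proof -
  obtain G where G: "bounded_clinear G" "\<And>x. G x - A (G x) = x" "\<And>x. G (x - A x) = x"
    using neumann_inverse[OF assms] by blast
  have eq: "calk (\<lambda>x. x - A x) = 1 - calk A"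
    using calk_diff[OF bounded_clinear_id A] by (simp add: calk_id)
  have lin: "bounded_clinear (\<lambda>x. x - A x)"
    using bounded_clinear_diff_op[OF bounded_clinear_id A] by simp
  have "G \<circ> (\<lambda>x. x - A x) = id" "(\<lambda>x. x - A x) \<circ> G = id"
    using G(2,3) by (auto simp: fun_eq_iff)
  then have "calk G * (1 - calk A) = 1" "(1 - calk A) * calk G = 1"
    using calk_comp[OF G(1) lin] calk_comp[OF lin G(1)] by (simp_all add: eq calk_id)
  with that show ?thesis by blast
qed

subsection \<open>Ring identities for \<open>u t t = t\<close>\<close>

text \<open>Here \<open>l\<close> plays the part of a nonzero scalar. The relations give
  \<open>d * t = 0\<close>, \<open>u * d = 0\<close> and
  \<open>u * t * (t - l) = (1 - l * u) * t\<close>; the inverses \<open>s\<close> and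
  \<open>g\<close> turn these into formulas for \<open>t * s * d\<close> and \<open>s * d\<close>.
  Passing on to \<open>u * t * d = 0\<close> uses the involution and is left to the final
  proof.\<close>

lemma quasi_isometry_defect:
  fixes t u l li s g :: "'r::{ring,monoid_mult}"
  assumes utt: "u * t * t = t" and uut: "u * u * t = u"
    and l: "\<And>x. l * x = x * l" and li: "li * l = 1"
    and s: "(t - l) * s = 1" and g: "g * (1 - l * u) = 1"
  defines "d \<equiv> 1 - u * t"
  shows "u * t * d * d = 0"
proof -
  define q where "q = u * t"
  have qd: "q = 1 - d" by (simp add: q_def d_def)
  have dt: "d * t = 0" using utt by (simp add: d_def algebra_simps)
  have ud: "u * d = 0" using uut by (simp add: d_def algebra_simps)
  have uq: "u * q = u" using uut by (simp add: q_def algebra_simps)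
  have lx: "x * (l * y) = l * (x * y)" for x y by (metis l mult.assoc)
  have "q * (t - l) = (1 - l * u) * t"
    using utt by (simp add: q_def algebra_simps l[symmetric])
  then have q: "q = (1 - l * u) * t * s"
    by (metis s mult.assoc mult.right_neutral)
  then have ts: "t * s = g * q"
    by (metis g mult.assoc mult.left_neutral)
  have uqd: "u * q * d = 0" by (simp add: uq ud)
  \<comment> \<open>\<open>u\<close> annihilates \<open>q * d\<close>, so \<open>1 - l * u\<close>,
    and with it \<open>g\<close>, fixes this element.\<close>
  have "(1 - l * u) * (q * d) = q * d"
    using uqd by (simp add: algebra_simps)
  then have "g * (q * d) = q * d"
    by (metis g mult.assoc mult.left_neutral)
  then have tsd: "t * s * d = q * d" by (simp add: ts mult.assoc)
  have "q * s * d = u * (t * s * d)" by (simp add: q_def mult.assoc)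
  also have "\<dots> = 0" using uqd by (metis tsd mult.assoc)
  finally have qsd: "q * s * d = 0" .
  have "d * (t - l) = - (l * d)" using dt by (simp add: algebra_simps l[symmetric])
  then have "d = - (l * d) * s" by (metis s mult.assoc mult.right_neutral)
  then have "li * d = - (li * l * (d * s))" by (metis mult.assoc mult_minus_left mult_minus_right)
  then have ds: "d * s = - (li * d)" by (simp add: li)
  \<comment> \<open>Split along \<open>q + d = 1\<close>: the first summand vanishes and the second
    is known, so \<open>d = (t - l) * (s * d)\<close> becomes an equation without
    \<open>s\<close>.\<close>
  have "s * d = q * s * d + d * s * d" by (simp add: qd algebra_simps)
  then have sd: "s * d = - (li * d * d)" by (simp add: qsd ds)
  have "d = (t - l) * (s * d)" by (metis s mult.assoc mult.left_neutral)
  then have "l * d = l * ((t - l) * - (li * d * d))" by (simp add: sd)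
  also have "\<dots> = - ((t - l) * (li * l * (d * d)))"
    by (metis l mult.assoc mult_minus_right)
  finally have "l * d = - (t * d * d) + l * d * d" by (simp add: li algebra_simps)
  then have "t * d * d = - (l * q * d)" by (simp add: qd algebra_simps)
  then have "q * d * d = u * - (l * q * d)" by (simp add: q_def mult.assoc)
  also have "\<dots> = - (l * (u * q * d))" by (simp add: lx mult.assoc)
  finally have "q * d * d = 0" by (simp add: uqd)
  then show ?thesis by (simp add: q_def)
qed

text \<open>The formula for \<open>t * s\<close> becomes \<open>g - d\<close>. As \<open>s\<close>
  commutes with \<open>t\<close>, one may write \<open>t = (t - l) * (t * s)\<close>; multiplying by
  \<open>1 - l * u\<close> on the right eliminates \<open>g\<close> and leaves
  \<open>t * u + d = 1\<close>.\<close>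

lemma quasi_isometry_range:
  fixes t u l li s g :: "'r::{ring,monoid_mult}"
  assumes uut: "u * u * t = u"
    and l: "\<And>x. l * x = x * l" and li: "li * l = 1"
    and s: "(t - l) * s = 1" "s * (t - l) = 1" and g: "g * (1 - l * u) = 1"
    and utt: "u * t * t = t"
  defines "d \<equiv> 1 - u * t"
  assumes td: "t * d = 0" and du: "d * u = 0"
  shows "t * u = u * t"
proof -
  have ud: "u * d = 0" using uut by (simp add: d_def algebra_simps)
  have "u * t * (t - l) = (1 - l * u) * t"
    using utt by (simp add: algebra_simps l[symmetric])
  then have "u * t = (1 - l * u) * t * s"
    by (metis s(1) mult.assoc mult.right_neutral)
  then have ts: "t * s = g * (u * t)"
    by (metis g mult.assoc mult.left_neutral)
  have "(1 - l * u) * d = d" using ud by (simp add: algebra_simps)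
  then have "g * d = d" by (metis g mult.assoc mult.left_neutral)
  then have ts: "t * s = g - d" using ts by (simp add: d_def algebra_simps)
  have "(t - l) * t = t * (t - l)" using l by (simp add: algebra_simps)
  then have "s * t = t * s" by (metis s mult.assoc mult.left_neutral mult.right_neutral)
  then have "t = (t - l) * (t * s)" by (metis s(1) mult.assoc mult.left_neutral)
  also have "\<dots> = (t - l) * g + l * d" using td by (simp add: ts algebra_simps)
  finally have "t - l * d = (t - l) * g" by (simp add: algebra_simps)
  then have "(t - l * d) * (1 - l * u) = t - l"
    by (metis g mult.assoc mult.right_neutral)
  moreover have "d * (l * u) = 0" "t * (l * u) = l * (t * u)"
    by (metis l du mult.assoc mult_zero_right, metis l mult.assoc)
  ultimately have "l * (t * u + d) = l" by (simp add: algebra_simps)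
  then have "li * l * (t * u + d) = li * l" by (simp add: mult.assoc)
  then show ?thesis by (simp add: li d_def algebra_simps)
qed

text \<open>Commutation makes \<open>u * t\<close> an idempotent that splits the problem: on its
  range \<open>t\<close> has inverse \<open>u\<close>, and on the complement \<open>d\<close> both
  vanish.\<close>

lemma partial_unitary_resolvent:
  fixes t u l li g :: "'r::{ring,monoid_mult}"
  assumes utt: "u * t * t = t" and uut: "u * u * t = u" and comm: "t * u = u * t"
    and l: "\<And>x. l * x = x * l" and li: "li * l = 1"
    and g: "g * (1 - l * u) = 1" "(1 - l * u) * g = 1"
  shows "\<exists>s. s * (l - t) = 1 \<and> (l - t) * s = 1"
proof -
  define d where "d = 1 - u * t"
  have ud: "u * d = 0" using uut by (simp add: d_def algebra_simps)
  have "t * (u * t) = t" by (metis utt comm mult.assoc)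
  then have td: "t * d = 0" by (simp add: d_def algebra_simps)
  have lx: "x * (l * y) = l * (x * y)" for x y by (metis l mult.assoc)
  have "(1 - l * u) * d = d" using ud by (simp add: algebra_simps)
  then have gd: "g * d = d" by (metis g(1) mult.assoc mult.left_neutral)
  have lil: "l * li = 1" using l li by metis
  have lix: "li * x = x * li" for x
    by (metis l li lil mult.assoc mult.left_neutral mult.right_neutral)
  have "(1 - l * u) * t = t * (1 - l * u)" using comm by (simp add: algebra_simps lx)
  then have gt: "g * t = t * g"
    by (metis g mult.assoc mult.left_neutral mult.right_neutral)
  have "t * (u * t) = u * t * t" by (metis comm mult.assoc)
  then have "t * d = d * t" by (simp add: d_def algebra_simps)
  \<comment> \<open>An inverse assembled blockwise: on the complement \<open>l - t\<close> is
    \<open>l\<close>, and on the range of \<open>u * t\<close> it is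
    \<open>- t * (1 - l * u)\<close>, with inverse \<open>- g * u\<close>.\<close>
  define r where "r = li * d - g * u"
  have rt: "r * t = t * r"
  proof -
    have "li * d * t = t * (li * d)" by (metis \<open>t * d = d * t\<close> lix mult.assoc)
    moreover have "g * u * t = t * (g * u)" by (metis comm gt mult.assoc)
    ultimately show ?thesis by (simp add: r_def algebra_simps)
  qed
  have "(l - t) * g = g * (l - t)" by (simp add: left_diff_distrib right_diff_distrib gt l)
  then have "(l - t) * g * u = g * (l * u - u * t)"
    by (simp add: mult.assoc left_diff_distrib comm)
  also have "\<dots> = g * (d - (1 - l * u))" by (simp add: d_def)
  also have "\<dots> = d - 1" by (metis right_diff_distrib gd g(1))
  finally have 1: "(l - t) * (g * u) = d - 1" by (simp add: mult.assoc)
  have "(l - t) * (li * d) = d"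
    using td lil by (simp add: left_diff_distrib) (metis lix mult.assoc mult.left_neutral mult_zero_right diff_zero)
  then have "(l - t) * r = 1" unfolding r_def right_diff_distrib 1 by simp
  moreover have "r * (l - t) = (l - t) * r"
    using l rt by (simp add: algebra_simps)
  ultimately show ?thesis by metis
qed

subsection \<open>Hyponormal operators whose adjoint is a word\<close>

text \<open>The operator inequality \<open>T T\<^sup>* \<le> T\<^sup>* T\<close> written through
  norms, the form in which vectors are compared below.\<close>

definition hyponormal :: "('a::complex_hilbert_space \<Rightarrow> 'a) \<Rightarrow> bool" where
  "hyponormal T \<longleftrightarrow> bounded_clinear T \<and> (\<forall>x. norm (cadjoint T x) \<le> norm (T x))"

lemma norm_cadjoint_eq_if_normal:
  assumes "normal_operator N"
  shows "norm (cadjoint N x) = norm (N x)"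
proof -
  have N: "bounded_clinear N" and comm: "cadjoint N (N x) = N (cadjoint N x)"
    using assms by (auto simp: normal_operator_def fun_eq_iff)
  have "(norm (cadjoint N x))\<^sup>2 = Re (cinner (cadjoint N (N x)) x)"
    by (simp add: norm_sq_cinner comm cinner_cadjoint[OF N])
  also have "\<dots> = (norm (N x))\<^sup>2"
    by (simp add: norm_sq_cinner cinner_cadjoint'[OF N])
  finally show ?thesis by (simp add: power2_eq_iff_nonneg)
qed

text \<open>In the larger space \<open>N (V x) = V (T x)\<close>, and normality gives
  \<open>cadjoint N (V x)\<close> the norm of \<open>T x\<close>. Pairing this vector with
  \<open>V (cadjoint T x)\<close> yields \<open>(norm (cadjoint T x))\<^sup>2\<close>, and one
  factor cancels.\<close>

lemma subnormal_imp_hyponormal: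
  fixes T :: "'a::complex_hilbert_space \<Rightarrow> 'a"
  assumes "subnormal TYPE('k::complex_hilbert_space) T"
  shows "hyponormal T"
proof -
  obtain V :: "'a \<Rightarrow> 'k" and N :: "'k \<Rightarrow> 'k" where T: "bounded_clinear T"
    and V: "\<And>x y. cinner (V x) (V y) = cinner x y" and N: "normal_operator N"
    and NV: "\<And>x. N (V x) = V (T x)"
    using assms unfolding subnormal_def by blast
  have N': "bounded_clinear N" using N by (simp add: normal_operator_def)
  have normV: "norm (V x) = norm x" for x
    using V[of x x] by (simp add: cinner_self power2_eq_iff_nonneg del: of_real_power)
  have "norm (cadjoint T x) \<le> norm (T x)" for x
  proof -
    let ?y = "cadjoint T x"
    have "(norm ?y)\<^sup>2 = Re (cinner (V (T ?y)) (V x))"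
      by (simp add: norm_sq_cinner cinner_cadjoint[OF T] V)
    also have "\<dots> = Re (cinner (V ?y) (cadjoint N (V x)))"
      by (simp add: cinner_cadjoint[OF N'] flip: NV)
    also have "\<dots> \<le> norm (V ?y) * norm (cadjoint N (V x))" by (rule Re_cinner_le)
    also have "\<dots> = norm ?y * norm (T x)"
      by (simp add: norm_cadjoint_eq_if_normal[OF N] normV NV)
    finally show ?thesis
      by (cases "?y = 0") (simp_all add: power2_eq_square)
  qed
  with T show ?thesis by (simp add: hyponormal_def)
qed

section \<open>Words in an operator and its adjoint\<close>

lemma foldr_comp_append:
  "foldr (\<circ>) (xs @ ys) id = foldr (\<circ>) xs id \<circ> foldr (\<circ>) ys id"
  by (induction xs) (auto simp: comp_assoc)

text \<open>Membership in \<open>J\<close> asks for a spelling that contains the letter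
  \<open>T\<close>, which excludes the trivial spelling of \<open>cadjoint T\<close> by itself.
  Concatenation of spellings shows that \<open>J\<close> is an ideal.\<close>

lemma SI_semigroup_cadjoint_word:
  fixes T :: "'a::complex_hilbert_space \<Rightarrow> 'a"
  assumes SI: "SI_semigroup (star_semigroup T)"
  obtains Ws where "set Ws \<subseteq> {T, cadjoint T}" "T \<in> set Ws" "cadjoint T = foldr (\<circ>) Ws id"
proof -
  define J where "J = {foldr (\<circ>) Ws id | Ws. set Ws \<subseteq> {T, cadjoint T} \<and> T \<in> set Ws}"
  have T: "T \<in> J" unfolding J_def by (rule CollectI, rule exI[of _ "[T]"]) auto
  have "semigroup_ideal J (star_semigroup T)"
    unfolding semigroup_ideal_def
  proof (intro conjI ballI)
    show "J \<noteq> {}" using T by blast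
    show "J \<subseteq> star_semigroup T" by (auto simp: J_def star_semigroup_def)
    fix A X assume "A \<in> J" "X \<in> star_semigroup T"
    then obtain Ws Vs where W: "set Ws \<subseteq> {T, cadjoint T}" "T \<in> set Ws" "A = foldr (\<circ>) Ws id"
      and V: "set Vs \<subseteq> {T, cadjoint T}" "X = foldr (\<circ>) Vs id"
      by (auto simp: J_def star_semigroup_def)
    show "X \<circ> A \<in> J" unfolding J_def W V foldr_comp_append[symmetric]
      using W(1,2) V(1) by (intro CollectI exI[of _ "Vs @ Ws"]) auto
    show "A \<circ> X \<in> J" unfolding J_def W V foldr_comp_append[symmetric]
      using W(1,2) V(1) by (intro CollectI exI[of _ "Ws @ Vs"]) auto
  qed
  with SI T have "cadjoint T \<in> J" unfolding SI_semigroup_def by blast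
  with that show ?thesis unfolding J_def by blast
qed

lemma onorm_approx_unit_vectors:
  fixes T :: "'a::complex_hilbert_space \<Rightarrow> 'a"
  assumes T: "bounded_clinear T" and pos: "1 < onorm T"
  obtains X where "\<And>n. norm (X n) = 1" "(\<lambda>n. norm (T (X n))) \<longlonglongrightarrow> onorm T"
proof -
  have bl: "bounded_linear T" using T by (simp add: bounded_clinear_def)
  define b where "b n = onorm T - 1 / real (Suc n)" for n
  have "\<exists>x. norm x = 1 \<and> b n < norm (T x)" for n
  proof -
    have "b n < onorm T" by (simp add: b_def)
    \<comment> \<open>The assumption \<open>1 < onorm T\<close> keeps the threshold
      \<open>b n\<close> positive; \<open>onorm_bound\<close> asks for a nonnegative
      constant.\<close>
    moreover have "1 / real (Suc n) \<le> 1" by simp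
    then have "0 < b n" using pos unfolding b_def by linarith
    ultimately have "\<not> (\<forall>x. norm (T x) \<le> b n * norm x)"
      using onorm_bound[of "b n" T] by fastforce
    then obtain x where x: "b n * norm x < norm (T x)" by (auto simp: not_le)
    have "x \<noteq> 0" using x bounded_clinear_zero[OF T] by auto
    then show ?thesis
      using x by (intro exI[of _ "(1 / norm x) *\<^sub>R x"])
        (simp add: bounded_clinear_scaleR[OF T] field_simps)
  qed
  then obtain X where X: "\<And>n. norm (X n) = 1" "\<And>n. b n < norm (T (X n))" by metis
  have "(\<lambda>n. norm (T (X n))) \<longlonglongrightarrow> onorm T"
  proof (rule tendsto_sandwich)
    show "b \<longlonglongrightarrow> onorm T"
      unfolding b_def using tendsto_diff[OF tendsto_const LIMSEQ_inverse_real_of_nat, of "onorm T"]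
      by (simp add: inverse_eq_divide)
    show "\<forall>\<^sub>F n in sequentially. b n \<le> norm (T (X n))" using X(2) less_imp_le by (auto intro: always_eventually)
    show "\<forall>\<^sub>F n in sequentially. norm (T (X n)) \<le> onorm T"
      using onorm[OF bl] X(1) by (intro always_eventually allI) (metis mult.right_neutral)
  qed (rule tendsto_const)
  with X(1) that show ?thesis by blast
qed

text \<open>Along norm-attaining unit vectors \<open>x\<^sub>n\<close> a hyponormal operator behaves like a multiple of an
  isometry: with \<open>r = \<parallel>T\<parallel>\<close>, \<open>\<parallel>T\<^sup>j x\<^sub>n\<parallel> \<rightarrow> r\<^sup>j\<close> and \<open>T\<^sup>* T T\<^sup>j x\<^sub>n - r\<^sup>2 T\<^sup>j x\<^sub>n \<rightarrow> 0\<close>. Hence a word of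
  length \<open>k\<close> applied to \<open>T\<^sup>M x\<^sub>n\<close>, \<open>M \<ge> k\<close>, has norm tending to \<open>r\<^sup>M\<^sup>+\<^sup>k\<close>; comparing the two words in
  the hypothesis forces \<open>r \<le> 1\<close>.\<close>

lemma hyponormal_word_contraction:
  fixes T :: "'a::complex_hilbert_space \<Rightarrow> 'a"
  assumes hyp: "hyponormal T" and Ws: "set Ws \<subseteq> {T, cadjoint T}" "2 \<le> length Ws"
    and eq: "cadjoint T = foldr (\<circ>) Ws id"
  shows "norm (T x) \<le> norm x"
proof -
  define r where "r = onorm T"
  have T: "bounded_clinear T" and hypD: "\<And>x. norm (cadjoint T x) \<le> norm (T x)"
    using hyp by (auto simp: hyponormal_def)
  have Ta: "bounded_clinear (cadjoint T)" by (rule bounded_clinear_cadjoint[OF T])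
  have bl: "bounded_linear T" "bounded_linear (cadjoint T)"
    using T Ta by (simp_all add: bounded_clinear_def)
  have r0: "0 \<le> r" unfolding r_def by (rule onorm_pos_le[OF bl(1)])
  have Tr: "norm (T x) \<le> r * norm x" for x unfolding r_def by (rule onorm[OF bl(1)])
  have Tar: "norm (cadjoint T x) \<le> r * norm x" for x by (rule norm_cadjoint_le[OF T r0 Tr])
  have "r \<le> 1"
  proof (rule ccontr)
    assume "\<not> r \<le> 1"
    then have r1: "1 < r" by simp
    then obtain X where X: "\<And>n. norm (X n) = 1" "(\<lambda>n. norm (T (X n))) \<longlonglongrightarrow> r"
      using onorm_approx_unit_vectors[OF T] unfolding r_def by blast
    define Y where "Y j n = (T ^^ j) (X n)" for j n
    have YS: "Y (Suc j) n = T (Y j n)" for j n by (simp add: Y_def)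
    \<comment> \<open>Put \<open>v = Y j n\<close>. Expanding the square, with cross term
      \<open>r\<^sup>2 * (norm (T v))\<^sup>2\<close> and \<open>cadjoint T\<close> bounded by
      \<open>r\<close>, leaves
      \<open>r ^ 4 * (norm v)\<^sup>2 - r\<^sup>2 * (norm (T v))\<^sup>2\<close>, whose limit is
      zero.\<close>
    have defect: "(\<lambda>n. cadjoint T (Y (Suc j) n) - r\<^sup>2 *\<^sub>R Y j n) \<longlonglongrightarrow> 0"
      if 0: "(\<lambda>n. norm (Y j n)) \<longlonglongrightarrow> r ^ j" and 1: "(\<lambda>n. norm (Y (Suc j) n)) \<longlonglongrightarrow> r ^ Suc j" for j
    proof -
      let ?D = "\<lambda>n. cadjoint T (Y (Suc j) n) - r\<^sup>2 *\<^sub>R Y j n"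
      let ?b = "\<lambda>n. r ^ 4 * (norm (Y j n))\<^sup>2 - r\<^sup>2 * (norm (Y (Suc j) n))\<^sup>2"
      have "(norm (?D n))\<^sup>2 \<le> ?b n" for n
      proof -
        have "(norm (cadjoint T (Y (Suc j) n)))\<^sup>2 \<le> r\<^sup>2 * (norm (Y (Suc j) n))\<^sup>2"
          using power_mono[OF Tar norm_ge_zero, of _ 2] by (simp add: power_mult_distrib)
        moreover have "Re (cinner (cadjoint T (Y (Suc j) n)) (r\<^sup>2 *\<^sub>R Y j n)) = r\<^sup>2 * (norm (Y (Suc j) n))\<^sup>2"
          by (simp add: cinner_cadjoint'[OF T] bounded_clinear_scaleR[OF T] YS cinner_scaleR_right
              norm_sq_cinner del: of_real_power)
        ultimately show ?thesis
          unfolding norm_diff_sq by (simp add: power_mult_distrib)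
      qed
      moreover have "?b \<longlonglongrightarrow> r ^ 4 * (r ^ j)\<^sup>2 - r\<^sup>2 * (r ^ Suc j)\<^sup>2"
        by (intro tendsto_diff tendsto_mult tendsto_power tendsto_const 0 1)
      moreover have "r ^ 4 * (r ^ j)\<^sup>2 - r\<^sup>2 * (r ^ Suc j)\<^sup>2 = 0"
        by (simp add: power_mult_distrib eval_nat_numeral)
      ultimately have "(\<lambda>n. (norm (?D n))\<^sup>2) \<longlonglongrightarrow> 0"
        by (intro Lim_null_comparison[of "\<lambda>n. (norm (?D n))\<^sup>2" ?b]) (auto intro!: always_eventually)
      from tendsto_real_sqrt[OF this] show ?thesis by (simp add: tendsto_norm_zero_iff)
    qed
    \<comment> \<open>The upper estimate for the next power is \<open>Tr\<close>. The lower one is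
      hyponormality: \<open>norm (T (T v))\<close> is at least
      \<open>norm (cadjoint T (T v))\<close>, which is close to
      \<open>r\<^sup>2 * norm v\<close>.\<close>
    have norms: "(\<lambda>n. norm (Y j n)) \<longlonglongrightarrow> r ^ j \<and> (\<lambda>n. norm (Y (Suc j) n)) \<longlonglongrightarrow> r ^ Suc j" for j
    proof (induction j)
      case 0
      show ?case using X by (simp add: Y_def)
    next
      case (Suc j)
      then have 0: "(\<lambda>n. norm (Y j n)) \<longlonglongrightarrow> r ^ j" and 1: "(\<lambda>n. norm (Y (Suc j) n)) \<longlonglongrightarrow> r ^ Suc j"
        by auto
      let ?D = "\<lambda>n. cadjoint T (Y (Suc j) n) - r\<^sup>2 *\<^sub>R Y j n"
      have "(\<lambda>n. norm (Y (Suc (Suc j)) n)) \<longlonglongrightarrow> r ^ Suc (Suc j)"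
      proof (rule tendsto_sandwich)
        have "(\<lambda>n. r\<^sup>2 * norm (Y j n) - norm (?D n)) \<longlonglongrightarrow> r\<^sup>2 * r ^ j - 0"
          by (intro tendsto_diff tendsto_mult tendsto_const 0 tendsto_norm_zero defect 1)
        then show "(\<lambda>n. r\<^sup>2 * norm (Y j n) - norm (?D n)) \<longlonglongrightarrow> r ^ Suc (Suc j)"
          by (simp add: power2_eq_square mult.assoc)
        have "r\<^sup>2 * norm (Y j n) - norm (?D n) \<le> norm (Y (Suc (Suc j)) n)" for n
          using norm_triangle_ineq2[of "r\<^sup>2 *\<^sub>R Y j n" "- ?D n"] hypD[of "Y (Suc j) n"]
          by (simp add: YS norm_minus_commute)
        then show "\<forall>\<^sub>F n in sequentially. r\<^sup>2 * norm (Y j n) - norm (?D n) \<le> norm (Y (Suc (Suc j)) n)"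
          by simp
        show "\<forall>\<^sub>F n in sequentially. norm (Y (Suc (Suc j)) n) \<le> r * norm (Y (Suc j) n)"
          using Tr by (simp add: YS)
        show "(\<lambda>n. r * norm (Y (Suc j) n)) \<longlonglongrightarrow> r ^ Suc (Suc j)"
          using tendsto_mult[OF tendsto_const 1, of r] by simp
      qed
      with 1 show ?case by blast
    qed
    \<comment> \<open>Up to a null sequence, a letter \<open>T\<close> raises \<open>j\<close> by
      one, while \<open>cadjoint T\<close> lowers it by one and multiplies \<open>c\<close> by
      \<open>r\<^sup>2\<close>; either way \<open>c * r ^ j\<close> gains a factor \<open>r\<close>.
      The bound on \<open>j\<close> keeps it positive as long as another letter may follow.\<close>
    have word: "\<exists>j c. M \<le> j + length Vs \<and> 0 \<le> c \<and> c * r ^ j = r ^ (M + length Vs) \<and>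
        (\<lambda>n. foldr (\<circ>) Vs id (Y M n) - c *\<^sub>R Y j n) \<longlonglongrightarrow> 0"
      if "set Vs \<subseteq> {T, cadjoint T}" "length Vs \<le> M" for Vs M
      using that
    proof (induction Vs)
      case Nil
      show ?case by (rule exI[of _ M], rule exI[of _ 1]) simp
    next
      case (Cons A Vs)
      have "set Vs \<subseteq> {T, cadjoint T}" "length Vs \<le> M" using Cons.prems by simp_all
      from Cons.IH[OF this] obtain j c where j: "M \<le> j + length Vs" and c: "0 \<le> c" "c * r ^ j = r ^ (M + length Vs)"
        and lim: "(\<lambda>n. foldr (\<circ>) Vs id (Y M n) - c *\<^sub>R Y j n) \<longlonglongrightarrow> 0"
        by blast
      consider "A = T" | "A = cadjoint T" using Cons.prems by auto
      then show ?case
      proof cases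
        case 1
        have "(\<lambda>n. foldr (\<circ>) (A # Vs) id (Y M n) - c *\<^sub>R Y (Suc j) n) \<longlonglongrightarrow> 0"
          using bounded_linear.tendsto_zero[OF bl(1) lim]
          by (simp add: 1 YS bounded_clinear_diff[OF T] bounded_clinear_scaleR[OF T])
        moreover have "M \<le> Suc j + length (A # Vs)" "c * r ^ Suc j = r ^ (M + length (A # Vs))"
          using j c(2) by (simp_all add: mult.left_commute)
        ultimately show ?thesis using c(1) by blast
      next
        case 2
        obtain i where i: "j = Suc i" using j Cons.prems by (cases j) auto
        have "(\<lambda>n. cadjoint T (foldr (\<circ>) Vs id (Y M n)) - c *\<^sub>R cadjoint T (Y j n)) \<longlonglongrightarrow> 0"
          using bounded_linear.tendsto_zero[OF bl(2) lim]
          by (simp add: bounded_clinear_diff[OF Ta] bounded_clinear_scaleR[OF Ta])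
        moreover have "(\<lambda>n. c *\<^sub>R (cadjoint T (Y j n) - r\<^sup>2 *\<^sub>R Y i n)) \<longlonglongrightarrow> 0"
          using tendsto_scaleR[OF tendsto_const[of c] defect[of i]] norms[of i] by (simp add: i)
        ultimately have "(\<lambda>n. foldr (\<circ>) (A # Vs) id (Y M n) - (c * r\<^sup>2) *\<^sub>R Y i n) \<longlonglongrightarrow> 0"
          using tendsto_add[of _ 0 _ _ 0] by (fastforce simp: 2 scaleR_diff_right)
        moreover have "M \<le> i + length (A # Vs)" "c * r\<^sup>2 * r ^ i = r ^ (M + length (A # Vs))"
          using j c(2)[symmetric] i by (simp_all add: power2_eq_square mult_ac)
        moreover have "0 \<le> c * r\<^sup>2" using c(1) by simp
        ultimately show ?thesis by blast
      qed
    qed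
    have word_norm: "(\<lambda>n. norm (foldr (\<circ>) Vs id (Y M n))) \<longlonglongrightarrow> r ^ (M + length Vs)"
      if Vs: "set Vs \<subseteq> {T, cadjoint T}" "length Vs \<le> M" for Vs M
    proof -
      obtain j c where c: "0 \<le> c" "c * r ^ j = r ^ (M + length Vs)"
        and lim: "(\<lambda>n. foldr (\<circ>) Vs id (Y M n) - c *\<^sub>R Y j n) \<longlonglongrightarrow> 0"
        using word[OF Vs] by blast
      have "(\<lambda>n. norm (foldr (\<circ>) Vs id (Y M n)) - norm (c *\<^sub>R Y j n)) \<longlonglongrightarrow> 0"
        by (rule Lim_null_comparison[OF always_eventually tendsto_norm_zero[OF lim]])
          (simp only: real_norm_def norm_triangle_ineq3 HOL.simp_thms)
      moreover have "(\<lambda>n. norm (c *\<^sub>R Y j n)) \<longlonglongrightarrow> c * r ^ j"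
        using tendsto_mult[OF tendsto_const[of c] conjunct1[OF norms[of j]]] c(1) by simp
      ultimately have "(\<lambda>n. norm (foldr (\<circ>) Vs id (Y M n))) \<longlonglongrightarrow> 0 + c * r ^ j"
        using tendsto_add[of _ 0 _ _ "c * r ^ j"] by fastforce
      then show ?thesis by (simp add: c(2))
    qed
    \<comment> \<open>\<open>cadjoint T\<close> is spelled both by \<open>Ws\<close> and by a single
      letter. Equating the two limits gives equal exponents because \<open>1 < r\<close>.\<close>
    let ?M = "length Ws"
    have "(\<lambda>n. norm (cadjoint T (Y ?M n))) \<longlonglongrightarrow> r ^ (?M + ?M)"
      using word_norm[OF Ws(1), of ?M] by (simp add: eq)
    moreover have "(\<lambda>n. norm (cadjoint T (Y ?M n))) \<longlonglongrightarrow> r ^ (?M + 1)"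
      using word_norm[of "[cadjoint T]" ?M] Ws(2) by simp
    ultimately have "r ^ (?M + ?M) = r ^ (?M + 1)" by (rule LIMSEQ_unique)
    then have "?M = 1" using r1 by (simp only: power_inject_exp)
    with Ws(2) show False by simp
  qed
  then show ?thesis
    using Tr[of x] mult_right_mono[OF _ norm_ge_zero, of r 1 x] by simp
qed

text \<open>The self-commutator \<open>D\<close> is symmetric and its quadratic form vanishes;
  evaluating the form at \<open>x + D x\<close> polarises this to \<open>D x = 0\<close>.\<close>

lemma normal_if_norm_cadjoint_eq:
  fixes T :: "'a::complex_hilbert_space \<Rightarrow> 'a"
  assumes T: "bounded_clinear T" and eq: "\<And>x. norm (cadjoint T x) = norm (T x)"
  shows "T (cadjoint T x) = cadjoint T (T x)"
proof -
  define D where "D x = cadjoint T (T x) - T (cadjoint T x)" for x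
  note Ta = bounded_clinear_cadjoint[OF T]
  have add: "D (x + y) = D x + D y" for x y
    by (simp add: D_def bounded_clinear_add[OF T] bounded_clinear_add[OF Ta])
  have sym: "cinner (D x) y = cinner x (D y)" for x y
    by (simp add: D_def cinner_diff_left cinner_diff_right cinner_cadjoint[OF T]
        cinner_cadjoint'[OF T])
  have zero: "Re (cinner (D x) x) = 0" for x
  proof -
    have "Re (cinner (cadjoint T (T x)) x) = (norm (T x))\<^sup>2"
      by (simp add: cinner_cadjoint'[OF T] norm_sq_cinner)
    moreover have "Re (cinner (T (cadjoint T x)) x) = (norm (cadjoint T x))\<^sup>2"
      by (simp add: cinner_cadjoint[OF T] norm_sq_cinner)
    ultimately show ?thesis by (simp add: D_def cinner_diff_left eq)
  qed
  have "Re (cinner (D x) (D x)) = 0"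
  proof -
    have "Re (cinner (D (D x)) x) = Re (cinner (D x) (D x))" by (simp add: sym)
    then show ?thesis
      using zero[of "x + D x"] zero[of x] zero[of "D x"]
      by (simp add: add cinner_add_left cinner_add_right)
  qed
  then have "D x = 0" by (simp flip: norm_sq_cinner)
  then show ?thesis by (simp add: D_def)
qed

text \<open>The adjoint of the word writes \<open>T\<close> as
  \<open>cadjoint R \<circ> cadjoint B \<circ> cadjoint A\<close> with contractive letters. Hence
  \<open>norm (T x)\<close> is bounded by the norm after two letters alone, which yields
  \<open>norm (T x) \<le> norm (T (T x))\<close>.\<close>

lemma hyponormal_word_defect:
  fixes T :: "'a::complex_hilbert_space \<Rightarrow> 'a"
  assumes hyp: "hyponormal T" and Ws: "set Ws \<subseteq> {T, cadjoint T}" "2 \<le> length Ws"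
    and eq: "cadjoint T = foldr (\<circ>) Ws id"
  shows "cadjoint T (T (T x)) = T x"
proof -
  have T: "bounded_clinear T" and hypD: "\<And>x. norm (cadjoint T x) \<le> norm (T x)"
    using hyp by (auto simp: hyponormal_def)
  note Ta = bounded_clinear_cadjoint[OF T]
  have contr: "norm (T x) \<le> norm x" for x
    by (rule hyponormal_word_contraction[OF hyp Ws eq])
  have contra: "norm (cadjoint T x) \<le> norm x" for x
    using hypD contr order_trans by blast
  obtain A B Vs where W: "Ws = A # B # Vs"
    using Ws(2) by (metis Suc_le_length_iff numeral_2_eq_2)
  define R where "R = foldr (\<circ>) Vs id"
  have AB: "A \<in> {T, cadjoint T}" "B \<in> {T, cadjoint T}" "set Vs \<subseteq> {T, cadjoint T}"
    using Ws(1) by (auto simp: W)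
  have linAB: "bounded_clinear A" "bounded_clinear B" using AB T Ta by auto
  have R: "bounded_clinear R \<and> (\<forall>x. norm (R x) \<le> norm x)"
    using AB(3) unfolding R_def
  proof (induction Vs)
    case (Cons C Vs)
    have "set Vs \<subseteq> {T, cadjoint T}" using Cons.prems by simp
    with Cons.IH have IH: "bounded_clinear (foldr (\<circ>) Vs id)" "norm (foldr (\<circ>) Vs id x) \<le> norm x" for x
      by blast+
    have C: "bounded_clinear C" "\<And>x. norm (C x) \<le> norm x"
      using Cons.prems T Ta contr contra by auto
    have "norm ((C \<circ> foldr (\<circ>) Vs id) x) \<le> norm x" for x
      using C(2)[of "foldr (\<circ>) Vs id x"] IH(2)[of x] by (metis comp_apply order_trans)
    with bounded_clinear_comp[OF C(1) IH(1)] show ?case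
      unfolding foldr.simps comp_apply[of _ "\<lambda>x. foldr _ _ x"] by (metis comp_apply)
  qed (simp add: bounded_clinear_id[unfolded id_def] id_def)
  have "T = cadjoint (A \<circ> (B \<circ> R))"
    using cadjoint_cadjoint[OF T] by (simp add: eq W R_def)
  also have "\<dots> = cadjoint R \<circ> cadjoint B \<circ> cadjoint A"
    using R linAB by (simp add: cadjoint_comp bounded_clinear_comp)
  finally have fact: "T x = cadjoint R (cadjoint B (cadjoint A x))" for x
    by (simp add: fun_eq_iff)
  have le1: "norm (T x) \<le> norm (cadjoint B (cadjoint A x))" for x
    unfolding fact using norm_cadjoint_le[of R 1] R by simp
  have "norm (cadjoint B y) \<le> norm (T y)" "norm (cadjoint B y) \<le> norm y" for y
    using AB(2) hypD contr contra cadjoint_cadjoint[OF T] by auto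
  note leB = this
  have key: "norm (T x) \<le> norm (T (T x))" for x
  proof (cases "A = T")
    case True
    \<comment> \<open>This inequality opposes hyponormality, so \<open>T\<close> is normal and may
      be interchanged with its adjoint.\<close>
    have "norm (T x) \<le> norm (cadjoint T x)" for x
      using le1[of x] leB(2)[of "cadjoint T x"] by (simp add: True)
    then have "norm (cadjoint T x) = norm (T x)" for x using hypD by (simp add: order_antisym)
    from normal_if_norm_cadjoint_eq[OF T this]
    have "T (cadjoint T x) = cadjoint T (T x)" .
    then show ?thesis
      using le1[of x] leB(1)[of "cadjoint T x"] hypD[of "T x"] by (simp add: True)
  next
    case False
    then have "cadjoint A = T" using AB(1) cadjoint_cadjoint[OF T] by auto
    then show ?thesis using le1[of x] leB(1)[of "T x"] by simp
  qed
  let ?y = "cadjoint T (T (T x))"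
  \<comment> \<open>The cross term is \<open>(norm (T (T x)))\<^sup>2\<close>, which bounds the
    first summand by contractivity and the last by \<open>key\<close>.\<close>
  have "(norm (?y - T x))\<^sup>2 = (norm ?y)\<^sup>2 - 2 * (norm (T (T x)))\<^sup>2 + (norm (T x))\<^sup>2"
    by (simp add: norm_diff_sq cinner_cadjoint'[OF T] flip: norm_sq_cinner)
  also have "\<dots> \<le> 0"
  proof -
    have "(norm ?y)\<^sup>2 \<le> (norm (T (T x)))\<^sup>2" by (rule power_mono[OF contra norm_ge_zero])
    moreover have "(norm (T x))\<^sup>2 \<le> (norm (T (T x)))\<^sup>2" by (rule power_mono[OF key norm_ge_zero])
    ultimately show ?thesis by linarith
  qed
  finally show ?thesis by simp
qed

subsection \<open>Location of the essential spectrum\<close>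

text \<open>For \<open>1 < cmod z\<close> factor \<open>z - t = z (1 - t / z)\<close>; the second
  factor has a Neumann inverse.\<close>

lemma essential_spectrum_contraction:
  fixes T :: "'a::complex_hilbert_space \<Rightarrow> 'a"
  assumes T: "bounded_clinear T" and contr: "\<And>x. norm (T x) \<le> norm x"
  shows "essential_spectrum T \<subseteq> cball 0 1"
proof
  fix z assume z: "z \<in> essential_spectrum T"
  show "z \<in> cball 0 1"
  proof (rule ccontr)
    assume "z \<notin> cball 0 1"
    then have z1: "1 < cmod z" by simp
    then have z0: "z \<noteq> 0" by auto
    define A where "A = (\<lambda>x. (1 / z) *\<^sub>C T x)"
    have A: "bounded_clinear A"
      using bounded_clinear_comp[OF bounded_clinear_scale_op T] by (simp add: A_def comp_def)
    have "norm (A x) \<le> (1 / cmod z) * norm x" for x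
      using contr[of x] z1 by (simp add: A_def norm_scaleC norm_divide divide_right_mono)
    moreover have "0 \<le> 1 / cmod z" "1 / cmod z < 1" using z1 by (simp_all add: divide_less_eq)
    ultimately obtain g where g: "g * (1 - calk A) = 1" "(1 - calk A) * g = 1"
      using calk_neumann[OF A] by blast
    have "calk_scalar z * (1 - calk A) = calk_scalar z - calk T"
      using z0 by (simp add: A_def calk_scaleC[OF T] right_diff_distrib calk_scalar_mult calk_ident
          flip: mult.assoc)
    moreover have inv: "calk_scalar z * calk_scalar (1 / z) = (1 :: 'a calkin)"
      "calk_scalar (1 / z) * calk_scalar z = (1 :: 'a calkin)"
      using z0 by (simp_all add: calk_scalar_mult calk_ident)
    have "g * calk_scalar (1 / z) * (calk_scalar z * (1 - calk A)) = 1"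
      by (metis g(1) inv(2) mult.assoc mult.left_neutral)
    moreover have "(calk_scalar z * (1 - calk A)) * (g * calk_scalar (1 / z)) = 1"
      by (metis g(2) inv(1) mult.assoc mult.left_neutral)
    ultimately have "z \<notin> essential_spectrum T"
      unfolding not_in_essential_spectrum_iff[OF T] by metis
    with z show False by simp
  qed
qed

text \<open>The imaginary part of \<open>cinner (L x) x\<close> is
  \<open>Im z * (norm x)\<^sup>2\<close>. For nonreal \<open>z\<close> a multiple of
  \<open>L\<close> is therefore at distance less than one from the identity, so its class is
  invertible.\<close>

lemma essential_spectrum_selfadjoint:
  fixes T :: "'a::complex_hilbert_space \<Rightarrow> 'a"
  assumes T: "bounded_clinear T" and self: "cadjoint T = T"
  shows "essential_spectrum T \<subseteq> \<real>"
proof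
  fix z assume z: "z \<in> essential_spectrum T"
  show "z \<in> \<real>"
  proof (rule ccontr)
    assume "z \<notin> \<real>"
    then have b: "Im z \<noteq> 0" by (simp add: complex_is_Real_iff)
    define L where "L = (\<lambda>x. z *\<^sub>C x - T x)"
    have L: "bounded_clinear L"
      unfolding L_def by (intro bounded_clinear_diff_op bounded_clinear_scale_op T)
    obtain K where K: "K > 0" "\<And>x. norm (L x) \<le> K * norm x"
      using bounded_clinear_bound[OF L] by blast
    \<comment> \<open>The maximum with \<open>\<bar>Im z\<bar>\<close> keeps the radicand of
      \<open>q\<close> nonnegative.\<close>
    define M where "M = max K \<bar>Im z\<bar>"
    have M: "M > 0" "\<bar>Im z\<bar> \<le> M" "norm (L x) \<le> M * norm x" for x
    proof -
      show "M > 0" "\<bar>Im z\<bar> \<le> M" using K(1) by (auto simp: M_def)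
      have "K * norm x \<le> M * norm x" by (rule mult_right_mono) (simp_all add: M_def)
      with K(2)[of x] show "norm (L x) \<le> M * norm x" by simp
    qed
    \<comment> \<open>The factor \<open>- \<i>\<close> makes the imaginary part of the form real.
      The scale \<open>Im z / M\<^sup>2\<close> minimises
      \<open>1 - 2 * s * Im z + s\<^sup>2 * M\<^sup>2\<close> over real \<open>s\<close>, and the
      minimum is the square of \<open>q\<close>.\<close>
    define \<alpha> where "\<alpha> = - \<i> * of_real (Im z / M\<^sup>2)"
    have \<alpha>: "\<alpha> \<noteq> 0" "(cmod \<alpha>)\<^sup>2 = (Im z)\<^sup>2 / M ^ 4"
      using b M(1) by (simp_all add: \<alpha>_def norm_mult norm_divide power_divide norm_power flip: power_mult)
    define A where "A = (\<lambda>x. x - \<alpha> *\<^sub>C L x)"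
    have A: "bounded_clinear A" unfolding A_def
      using bounded_clinear_diff_op[OF bounded_clinear_id
          bounded_clinear_comp[OF bounded_clinear_scale_op L]] by (simp add: comp_def)
    define q where "q = sqrt (1 - (Im z)\<^sup>2 / M\<^sup>2)"
    have "(Im z)\<^sup>2 \<le> M\<^sup>2" using M(2) by (metis abs_ge_zero power2_abs power_mono)
    then have q0: "0 \<le> 1 - (Im z)\<^sup>2 / M\<^sup>2" using M(1) by simp
    have q: "0 \<le> q" "q < 1" "q\<^sup>2 = 1 - (Im z)\<^sup>2 / M\<^sup>2"
      using q0 b M(1) by (simp_all add: q_def)
    have "norm (A x) \<le> q * norm x" for x
    proof -
      have "Im (cinner (T x) x) = 0"
        using cinner_commute[of "T x" x] cinner_cadjoint[OF T, of x x] self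
        by (metis complex_cnj_cancel_iff cnj.simps(2) complex_cnj equal_neg_zero)
      then have "Im (cinner (L x) x) = Im z * (norm x)\<^sup>2"
        by (simp add: L_def cinner_diff_left cinner_scaleC_left cinner_self del: of_real_power)
      then have re: "Re (cinner x (\<alpha> *\<^sub>C L x)) = (Im z)\<^sup>2 / M\<^sup>2 * (norm x)\<^sup>2"
        by (subst Re_cinner_commute) (simp add: cinner_scaleC_left \<alpha>_def power2_eq_square)
      have "(norm (L x))\<^sup>2 \<le> M\<^sup>2 * (norm x)\<^sup>2"
        using power_mono[OF M(3) norm_ge_zero, of x 2] by (simp add: power_mult_distrib)
      then have "(Im z)\<^sup>2 / M ^ 4 * (norm (L x))\<^sup>2 \<le> (Im z)\<^sup>2 / M ^ 4 * (M\<^sup>2 * (norm x)\<^sup>2)"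
        by (intro mult_left_mono) auto
      also have "\<dots> = (Im z)\<^sup>2 / M\<^sup>2 * (norm x)\<^sup>2"
        using M(1) by (simp add: eval_nat_numeral field_simps)
      finally have "(norm (A x))\<^sup>2 \<le> (q * norm x)\<^sup>2"
        by (simp add: A_def norm_diff_sq re norm_scaleC power_mult_distrib \<alpha>(2) q(3) algebra_simps)
      then show ?thesis using q(1) by (intro power2_le_imp_le[of "norm (A x)"]) auto
    qed
    with q obtain g where g: "g * (1 - calk A) = 1" "(1 - calk A) * g = 1"
      using calk_neumann[OF A] by blast
    define c where "c = calk_scalar z - calk T"
    have c: "c = calk L"
      using calk_diff[OF bounded_clinear_scale_op T] by (simp add: c_def L_def)
    have "calk A = 1 - calk_scalar \<alpha> * c"
      using calk_diff[OF bounded_clinear_id bounded_clinear_comp[OF bounded_clinear_scale_op L]]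
      by (simp add: A_def comp_def calk_id calk_scaleC[OF L] c)
    then have eq: "1 - calk A = calk_scalar \<alpha> * c" by simp
    have "g * calk_scalar \<alpha> * c = 1" using g(1) by (simp add: eq mult.assoc)
    moreover have "c * (g * calk_scalar \<alpha>) = 1"
      using g(2) unfolding eq by (metis calk_scalar_central mult.assoc)
    ultimately have "z \<notin> essential_spectrum T"
      unfolding not_in_essential_spectrum_iff[OF T] c_def[symmetric] by metis
    with z show False by simp
  qed
qed

lemma emeasure_lebesgue_reals: "S \<subseteq> \<real> \<Longrightarrow> emeasure lebesgue (S :: complex set) = 0"
proof -
  assume S: "S \<subseteq> \<real>"
  have "negligible {z::complex. \<i> \<bullet> z = 0}" by (rule negligible_hyperplane) simp
  then have "negligible S"
    by (rule negligible_subset) (use S in \<open>auto simp: complex_is_Real_iff inner_complex_def\<close>)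
  then show ?thesis by (simp add: negligible_iff_null_sets null_sets_def)
qed

text \<open>A set that is not known to be Lebesgue measurable may have \<open>emeasure\<close> zero for lack of
  measurability; here it lies between two discs that differ by a null set.\<close>

lemma missing_point_of_disc:
  fixes S :: "complex set"
  assumes sub: "S \<subseteq> cball 0 1" and null: "emeasure lebesgue S = 0"
  obtains z where "z \<noteq> 0" "cmod z < 1" "z \<notin> S"
proof -
  have "\<not> ball 0 1 - {0} \<subseteq> S"
  proof
    assume sup: "ball 0 1 - {0} \<subseteq> S"
    \<comment> \<open>Outside the punctured open disc \<open>S\<close> can contain only
      \<open>0\<close> and points of the circle. It is therefore measurable, and its zero
      \<open>emeasure\<close> really makes it negligible.\<close>
    have "negligible (S \<inter> ({0} \<union> sphere 0 1))"
      by (rule negligible_subset[of "{0} \<union> sphere 0 1"]) (auto simp: negligible_sphere negligible_Un)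
    then have "S \<inter> ({0} \<union> sphere 0 1) \<in> sets lebesgue" by (rule negligible_imp_sets)
    moreover have "S = (ball 0 1 - {0}) \<union> (S \<inter> ({0} \<union> sphere 0 1))"
      using sub sup by (auto simp: subset_iff)
    moreover have "ball 0 1 - {0::complex} \<in> sets lebesgue" by (intro sets.Diff) auto
    ultimately have "S \<in> sets lebesgue" by (metis sets.Un)
    then have "negligible S" using null by (simp add: negligible_iff_null_sets null_sets_def)
    then have "negligible (insert 0 S)" by simp
    then have "negligible (ball (0::complex) 1)" by (rule negligible_subset) (use sup in auto)
    then show False using open_not_negligible[of "ball (0::complex) 1"] by simp
  qed
  then obtain z where "z \<in> ball 0 1 - {0}" "z \<notin> S" by blast
  with that show ?thesis by auto
qed

section \<open>From the essential spectrum to essential normality and back\<close>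

theorem corollary4p16:
  fixes T :: "'h::complex_hilbert_space \<Rightarrow> 'h"
  assumes "bounded_clinear T"
    and "subnormal TYPE('k::complex_hilbert_space) T"
    and "SI_semigroup (star_semigroup T)"
  shows "essentially_normal T \<longleftrightarrow> emeasure lebesgue (essential_spectrum T) = 0"
proof -
  note T = assms(1)
  note Ta = bounded_clinear_cadjoint[OF T]
  have hyp: "hyponormal T" by (rule subnormal_imp_hyponormal[OF assms(2)])
  obtain Ws where Ws: "set Ws \<subseteq> {T, cadjoint T}" "T \<in> set Ws" and word: "cadjoint T = foldr (\<circ>) Ws id"
    by (rule SI_semigroup_cadjoint_word[OF assms(3)])
  show ?thesis
  proof (cases "cadjoint T = T")
    \<comment> \<open>Both sides hold: commutation is immediate and the essential spectrum lies on
      the real line.\<close>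
    case True
    then show ?thesis
      using emeasure_lebesgue_reals[OF essential_spectrum_selfadjoint[OF T]]
      by (simp add: essentially_normal_iff[OF T])
  next
    case False
    \<comment> \<open>A spelling of length at most one that contains \<open>T\<close> is
      \<open>[T]\<close>, which would make \<open>T\<close> selfadjoint.\<close>
    have len: "2 \<le> length Ws"
    proof (rule ccontr)
      assume "\<not> 2 \<le> length Ws"
      then have "Ws = [T]" using Ws(2) by (cases Ws) (auto simp: not_le less_Suc_eq_0_disj numeral_2_eq_2)
      with word False show False by simp
    qed
    have contr: "norm (T x) \<le> norm x" for x
      by (rule hyponormal_word_contraction[OF hyp Ws(1) len word])
    have 1: "cadjoint T \<circ> T \<circ> T = T"
      using hyponormal_word_defect[OF hyp Ws(1) len word] by (auto simp: fun_eq_iff)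
    have "cadjoint T \<circ> cadjoint T \<circ> T = cadjoint (cadjoint T \<circ> T \<circ> T)"
      using T Ta by (simp add: cadjoint_comp bounded_clinear_comp cadjoint_cadjoint comp_assoc)
    then have 2: "cadjoint T \<circ> cadjoint T \<circ> T = cadjoint T" by (simp add: 1)
    define t u where "t = calk T" and "u = calk (cadjoint T)"
    have utt: "u * t * t = t"
      using arg_cong[OF 1, of calk] T Ta by (simp add: t_def u_def calk_comp bounded_clinear_comp)
    have uut: "u * u * t = u"
      using arg_cong[OF 2, of calk] T Ta by (simp add: t_def u_def calk_comp bounded_clinear_comp)
    have spec: "z \<notin> essential_spectrum T \<longleftrightarrow>
        (\<exists>s. s * (calk_scalar z - t) = 1 \<and> (calk_scalar z - t) * s = 1)" for z
      using not_in_essential_spectrum_iff[OF T] by (simp add: t_def)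
    have sub: "essential_spectrum T \<subseteq> cball 0 1"
      by (rule essential_spectrum_contraction[OF T contr])
    have li: "calk_scalar (1 / z) * calk_scalar z = (1 :: 'h calkin)" if "z \<noteq> 0" for z
      using that by (simp add: calk_scalar_mult calk_ident)
    have resolvent: "\<exists>g. g * (1 - calk_scalar z * u) = 1 \<and> (1 - calk_scalar z * u) * g = 1"
      if "cmod z < 1" for z
    proof -
      define A where "A = (\<lambda>x. z *\<^sub>C cadjoint T x)"
      have A: "bounded_clinear A"
        using bounded_clinear_comp[OF bounded_clinear_scale_op Ta] by (simp add: A_def comp_def)
      have "norm (A x) \<le> cmod z * norm x" for x
        using norm_cadjoint_le[OF T, of 1] contr by (simp add: A_def norm_scaleC mult_left_mono)
      moreover have "calk A = calk_scalar z * u" by (simp add: A_def calk_scaleC[OF Ta] u_def)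
      ultimately show ?thesis using calk_neumann[OF A _ that] by auto
    qed
    show ?thesis
    proof
      assume "essentially_normal T"
      then have comm: "t * u = u * t" by (simp add: essentially_normal_iff[OF T] t_def u_def)
      have "z \<notin> essential_spectrum T" if z: "z \<noteq> 0" "cmod z < 1" for z
      proof -
        obtain g where "g * (1 - calk_scalar z * u) = 1" "(1 - calk_scalar z * u) * g = 1"
          using resolvent[OF z(2)] by blast
        from partial_unitary_resolvent[OF utt uut comm calk_scalar_central li[OF z(1)] this]
        show ?thesis by (simp add: spec)
      qed
      then have "essential_spectrum T \<subseteq> {0} \<union> sphere 0 1"
        using sub by (force simp: subset_iff)
      then have "negligible (essential_spectrum T)"
        by (rule negligible_subset[rotated]) (simp add: negligible_sphere negligible_Un)
      then show "emeasure lebesgue (essential_spectrum T) = 0"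
        by (simp add: negligible_iff_null_sets null_sets_def)
    next
      assume null: "emeasure lebesgue (essential_spectrum T) = 0"
      obtain z where z: "z \<noteq> 0" "cmod z < 1" "z \<notin> essential_spectrum T"
        by (rule missing_point_of_disc[OF sub null])
      obtain s where s: "s * (calk_scalar z - t) = 1" "(calk_scalar z - t) * s = 1"
        using z(3) spec by blast
      obtain g where g: "g * (1 - calk_scalar z * u) = 1"
        using resolvent[OF z(2)] by blast
      \<comment> \<open>The ring identities are phrased for \<open>t - l\<close>, the spectrum for
        \<open>l - t\<close>.\<close>
      have s': "(t - calk_scalar z) * (- s) = 1" "(- s) * (t - calk_scalar z) = 1"
        using s by (simp_all add: algebra_simps)
      \<comment> \<open>\<open>calk_cstar\<close> speaks of operators, so selfadjoint
        representatives are fixed for \<open>1 - u * t\<close> and \<open>u * t\<close>.\<close>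
      define D where "D = (\<lambda>x. x - cadjoint T (T x))"
      define Q where "Q = cadjoint T \<circ> T"
      have Q: "bounded_clinear Q" unfolding Q_def by (intro bounded_clinear_comp T Ta)
      have D: "bounded_clinear D"
        using bounded_clinear_diff_op[OF bounded_clinear_id Q] by (simp add: D_def Q_def)
      have cQ: "calk Q = u * t" by (simp add: Q_def calk_comp T Ta t_def u_def)
      have cD: "calk D = 1 - u * t"
        using calk_diff[OF bounded_clinear_id Q] by (simp add: D_def Q_def cQ[unfolded Q_def] calk_id)
      have aQ: "cadjoint Q = Q" by (simp add: Q_def cadjoint_comp T Ta cadjoint_cadjoint)
      have aD: "cadjoint D = D"
        using cadjoint_diff[OF bounded_clinear_id Q] aQ by (simp add: D_def Q_def cadjoint_id)
      define d where "d = 1 - u * t"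
      have qdd: "u * t * d * d = 0"
        unfolding d_def
        by (rule quasi_isometry_defect[OF utt uut calk_scalar_central li[OF z(1)] s'(1) g])
      \<comment> \<open>With \<open>q = u * t\<close>, the adjoint of \<open>q * d\<close> times
        \<open>q * d\<close> is \<open>d * q * q * d\<close>; as \<open>q\<close> and
        \<open>d\<close> commute, this is \<open>q * (q * d * d) = 0\<close>, and the C*-identity
        removes one \<open>d\<close>.\<close>
      have "d * (u * t) = u * t * d" by (simp add: d_def algebra_simps)
      then have "d * (u * t) * (u * t * d) = u * t * (u * t * d * d)"
        by (metis mult.assoc)
      also have "\<dots> = 0" by (simp add: qdd)
      finally have "calk (cadjoint (Q \<circ> D)) * calk (Q \<circ> D) = 0"
        using Q D by (simp add: cadjoint_comp aQ aD calk_comp cQ cD d_def)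
      from calk_cstar[OF bounded_clinear_comp[OF Q D] this] have qd: "u * t * d = 0"
        using Q D by (simp add: calk_comp cQ cD d_def)
      \<comment> \<open>The same device for \<open>t * d\<close>: its adjoint times itself is
        \<open>d * (u * t * d)\<close>.\<close>
      have "calk (cadjoint (T \<circ> D)) * calk (T \<circ> D) = d * (u * t * d)"
        using T D Ta by (simp add: cadjoint_comp aD calk_comp cD d_def t_def u_def mult.assoc)
      also have "\<dots> = 0" by (simp add: qd)
      finally have "calk (T \<circ> D) = 0" by (rule calk_cstar[OF bounded_clinear_comp[OF T D]])
      then have td: "t * (1 - u * t) = 0" using T D by (simp add: calk_comp cD t_def)
      \<comment> \<open>The class of \<open>D \<circ> cadjoint T\<close> is the adjoint of that of
        \<open>T \<circ> D\<close>; its vanishing is carried over through compactness of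
        adjoints.\<close>
      have "T \<circ> D \<in> compact_operators"
        using \<open>calk (T \<circ> D) = 0\<close> T D by (simp add: calk_eq_0_iff bounded_clinear_comp)
      then have "D \<circ> cadjoint T \<in> compact_operators"
        using compact_operators_cadjoint[of "T \<circ> D"] T D by (simp add: cadjoint_comp aD)
      then have "calk (D \<circ> cadjoint T) = 0"
        using D Ta by (simp add: calk_eq_0_iff bounded_clinear_comp)
      then have du: "(1 - u * t) * u = 0" using D Ta by (simp add: calk_comp cD u_def)
      have "t * u = u * t"
        by (rule quasi_isometry_range[OF uut calk_scalar_central li[OF z(1)] s' g utt td du])
      then show "essentially_normal T" by (simp add: essentially_normal_iff[OF T] t_def u_def)
    qed
  qed
qed

end
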